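(* Let $T>0$, $n\in\mathbb{N}$, $\{\alpha_j\}_{j=1}^n\subset(0,1]$, and let $p\in(1,\infty)$ satisfy $p>\max\{1/\alpha_j : j\in\{1,\dots,n\}\}$. Let $f=(f_1,\dots,f_n):\mathbb{R}^n\times[0,T]\to\mathbb{R}^n$ be an $L^p$-Carathéodory function and let $\xi=(\xi_1,\dots,\xi_n)\in\mathbb{R}^n$. Then a function $\varphi=(\varphi_1,\dots,\varphi_n):[0,T]\to\mathbb{R}^n$ is a solution on $[0,T]$ of the Cauchy problem $${}^C\!D_t^{\alpha_j}\varphi_j(t)=f_j\big(\varphi_1(t),\dots,\varphi_n(t),t\big)\ \text{ for a.e. } t\in[0,T],\qquad \varphi_j(0)=\xi_j,\qquad j=1,\dots,n,$$ if and only if it satisfies the system of integral equations $$\varphi_j(t)=\xi_j+\frac{1}{\Gamma(\alpha_j)}\int_0^t(t-s)^{\alpha_j-1}f_j\big(\varphi(s),s\big)\,ds\quad\text{for all }t\in[0,T],$$ for every $j\in\{1,\dots,n\}$.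
   Context: $\|\cdot\|_{\mathbb{R}^n}$ is a fixed (say Euclidean) norm on $\mathbb{R}^n$. That $\varphi$ satisfies the integral equations includes that the integrals appearing in them exist as Lebesgue integrals. Carathéodory function: $f:\mathbb{R}^n\times[0,T]\to\mathbb{R}^n$ such that (i) $x\mapsto f(x,t)$ is continuous for almost every $t\in[0,T]$; (ii) $t\mapsto f(x,t)$ is Lebesgue measurable for every $x\in\mathbb{R}^n$. $L^p$-Carathéodory function ($1\le p<\infty$): a Carathéodory function $f$ such that (a) there exist $\gamma\in L^p(0,T)$ and a constant $C>0$ with $\|f(x,t)\|_{\mathbb{R}^n}\le C\|x\|_{\mathbb{R}^n}+\gamma(t)$ for all $x\in\mathbb{R}^n$ and almost every $t\in[0,T]$; (b) there exists $l\in L^1(0,T)$ with $\|f(x,t)-f(y,t)\|_{\mathbb{R}^n}\le l(t)\|x-y\|_{\mathbb{R}^n}$ for all $x,y\in\mathbb{R}^n$ and almost every $t\in[0,T]$. Riemann–Liouville fractional integral of order $\alpha>0$ of $g\in L^1(0,T;\mathbb{R}^m)$: $J_t^\alpha g(t)=\frac{1}{\Gamma(\alpha)}\int_0^t(t-s)^{\alpha-1}g(s)\,ds$ for a.e. $t\in[0,T]$. Caputo fractional derivative of order $\alpha\in(0,1)$ of $g\in C([0,T];\mathbb{R}^m)$ with $J_t^{1-\alpha}g\in W^{1,1}(0,T;\mathbb{R}^m)$: ${}^C\!D_t^\alpha g(t)=\frac{d}{dt}\{J_t^{1-\alpha}[g(t)-g(0)]\}$ for a.e. $t\in[0,T]$,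 where $d/dt$ is the weak derivative. For $\alpha=1$, ${}^C\!D_t^1 g=g'$ is the usual weak derivative of $g\in W^{1,1}(0,T;\mathbb{R}^m)$. Solution: $\varphi:[0,T]\to\mathbb{R}^n$ is a solution of the Cauchy problem on $[0,T]$ if $\varphi\in C([0,T];\mathbb{R}^n)$, the Caputo derivatives ${}^C\!D_t^{\alpha_j}\varphi_j$ exist in the sense above with $({}^C\!D_t^{\alpha_1}\varphi_1,\dots,{}^C\!D_t^{\alpha_n}\varphi_n)\in L^p(0,T;\mathbb{R}^n)$, and $\varphi$ satisfies the equations and the initial conditions. *)

theory Defs
  imports "HOL-Analysis.Analysis"
begin

text \<open>
  Functions on \<open>[0,T]\<close> are rendered as total functions on \<open>real\<close>; all notions below depend only on
  their values on \<open>[0,T]\<close>.  Elements of \<open>L\<^sup>p\<close> are represented by functions rather than by classes of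
  almost everywhere equal functions.
\<close>

definition Lp :: "real \<Rightarrow> real \<Rightarrow> (real \<Rightarrow> 'a::euclidean_space) set" where
  "Lp p T = {g \<in> borel_measurable (lebesgue_on {0<..<T}).
               integrable (lebesgue_on {0<..<T}) (\<lambda>t. norm (g t) powr p)}"

definition test_function :: "real \<Rightarrow> (real \<Rightarrow> real) \<Rightarrow> bool" where
  "test_function T \<psi> \<longleftrightarrow>
     (\<forall>k x. (deriv ^^ k) \<psi> differentiable (at x)) \<and>
     compact (closure {x. \<psi> x \<noteq> 0}) \<and> closure {x. \<psi> x \<noteq> 0} \<subseteq> {0<..<T}"

definition is_weak_derivative ::
    "real \<Rightarrow> (real \<Rightarrow> 'a::euclidean_space) \<Rightarrow> (real \<Rightarrow> 'a) \<Rightarrow> bool" where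
  "is_weak_derivative T u v \<longleftrightarrow> u \<in> Lp 1 T \<and> v \<in> Lp 1 T \<and>
     (\<forall>\<psi>. test_function T \<psi> \<longrightarrow>
        (LINT t|lebesgue_on {0<..<T}. deriv \<psi> t *\<^sub>R u t)
          = - (LINT t|lebesgue_on {0<..<T}. \<psi> t *\<^sub>R v t))"

definition W11 :: "real \<Rightarrow> (real \<Rightarrow> 'a::euclidean_space) set" where
  "W11 T = {u. \<exists>v. is_weak_derivative T u v}"

definition RL_integral :: "real \<Rightarrow> (real \<Rightarrow> 'a::euclidean_space) \<Rightarrow> real \<Rightarrow> 'a" where
  "RL_integral \<alpha> g t =
     (1 / Gamma \<alpha>) *\<^sub>R (LINT s|lebesgue_on {0<..<t}. (t - s) powr (\<alpha> - 1) *\<^sub>R g s)"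

text \<open>
  \<open>is_caputo_derivative T \<alpha> g v\<close>: the Caputo derivative of order \<open>\<alpha> \<in> (0,1]\<close> of \<open>g\<close> exists on
  \<open>[0,T]\<close> and is represented by \<open>v\<close>, which is thereby determined up to a null set.
\<close>

definition is_caputo_derivative ::
    "real \<Rightarrow> real \<Rightarrow> (real \<Rightarrow> 'a::euclidean_space) \<Rightarrow> (real \<Rightarrow> 'a) \<Rightarrow> bool" where
  "is_caputo_derivative T \<alpha> g v \<longleftrightarrow>
     (0 < \<alpha> \<and> \<alpha> < 1 \<and> continuous_on {0..T} g \<and> RL_integral (1 - \<alpha>) g \<in> W11 T \<and>
        is_weak_derivative T (RL_integral (1 - \<alpha>) (\<lambda>s. g s - g 0)) v) \<or>
     (\<alpha> = 1 \<and> g \<in> W11 T \<and> is_weak_derivative T g v)"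

definition caratheodory ::
    "real \<Rightarrow> ('a::euclidean_space \<Rightarrow> real \<Rightarrow> 'a) \<Rightarrow> bool" where
  "caratheodory T f \<longleftrightarrow>
     (AE t in lebesgue_on {0..T}. continuous_on UNIV (\<lambda>x. f x t)) \<and>
     (\<forall>x. (\<lambda>t. f x t) \<in> borel_measurable (lebesgue_on {0..T}))"

text \<open>
  The exceptional null sets in the two bounds may depend on \<open>x\<close> and \<open>y\<close>.  Since \<open>f\<close> is continuous in
  its first argument for almost every \<open>t\<close>, this is equivalent to requiring a common null set.
\<close>

definition Lp_caratheodory ::
    "real \<Rightarrow> real \<Rightarrow> ('a::euclidean_space \<Rightarrow> real \<Rightarrow> 'a) \<Rightarrow> bool" where
  "Lp_caratheodory p T f \<longleftrightarrow> caratheodory T f \<and>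
     (\<exists>\<gamma> \<in> Lp p T. \<exists>C>0. \<forall>x. AE t in lebesgue_on {0..T}.
        norm (f x t) \<le> C * norm x + (\<gamma> t :: real)) \<and>
     (\<exists>l \<in> Lp 1 T. \<forall>x y. AE t in lebesgue_on {0..T}.
        norm (f x t - f y t) \<le> (l t :: real) * norm (x - y))"

definition cauchy_solution ::
    "real \<Rightarrow> real \<Rightarrow> ('n::finite \<Rightarrow> real) \<Rightarrow> (real^'n \<Rightarrow> real \<Rightarrow> real^'n) \<Rightarrow> real^'n
      \<Rightarrow> (real \<Rightarrow> real^'n) \<Rightarrow> bool" where
  "cauchy_solution p T \<alpha> f \<xi> \<phi> \<longleftrightarrow> continuous_on {0..T} \<phi> \<and>
     (\<exists>v \<in> Lp p T.
        (\<forall>j. is_caputo_derivative T (\<alpha> j) (\<lambda>t. \<phi> t $ j) (\<lambda>t. v t $ j)) \<and>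
        (\<forall>j. AE t in lebesgue_on {0..T}. v t $ j = f (\<phi> t) t $ j)) \<and>
     (\<forall>j. \<phi> 0 $ j = \<xi> $ j)"

end

theory Submission
  imports Defs
begin

text \<open>
  With \<open>J\<close> the Riemann--Liouville integral, \<open>J\<^bsup>1-a\<^esup> J\<^bsup>a\<^esup> = J\<^bsup>1\<^esup>\<close> by Fubini and the Beta
  integral, and \<open>J\<^bsup>1\<^esup> g\<close> has weak derivative \<open>g\<close>.  Hence \<open>\<phi> = \<xi> + J\<^bsup>a\<^esup> g\<close> has Caputo derivative
  \<open>g\<close>.  Conversely, if \<open>\<phi>\<close> has Caputo derivative \<open>g\<close>, then \<open>J\<^bsup>1-a\<^esup> (\<phi> - \<phi> 0 - J\<^bsup>a\<^esup> g) = 0\<close> by the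
  lemma of du Bois-Reymond, and applying \<open>J\<^bsup>a\<^esup>\<close> and differentiating gives
  \<open>\<phi> = \<phi> 0 + J\<^bsup>a\<^esup> g\<close>.  Both arguments need \<open>g\<close> in \<open>L\<^sup>p\<close> with \<open>a p > 1\<close>, so that
  \<open>J\<^bsup>a\<^esup> g\<close> is continuous.  For a solution of the integral equations, \<open>g = f(\<phi>, \<cdot>)\<close> is a priori only
  integrable; the linear growth of \<open>f\<close> then gives a weakly singular Volterra inequality for the norm
  of \<open>\<phi>\<close>, which forces \<open>\<phi>\<close> to be bounded and \<open>g\<close> to be in \<open>L\<^sup>p\<close>.
\<close>

subsection \<open>Smooth test functions\<close>

text \<open>The statement integrates over \<open>lebesgue_on\<close> an interval, that is, with
  respect to a completed measure, while Fubini and joint measurability are convenient for Borel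
  functions on the line. Every density is therefore replaced by a Borel representative that vanishes
  outside (0,T), and every integral over (0,t) by a convolution on the whole line with a kernel that
  vanishes for nonpositive arguments. The condition a p > 1 says exactly that the kernel u^(a-1) has
  a locally integrable q-th power, where q is the exponent conjugate to p. For a < 1 the Caputo
  derivative also requires J^(1-a) \<phi> itself, without subtraction of \<phi> 0, to lie in
  \<open>W11\<close>. The constant adds \<phi> 0 t^(-a) / Gamma(1-a) to the weak derivative, which
  is integrable though unbounded. A function that satisfies the integral equations is not known to
  be measurable at first; the measurability of f(\<phi>, .) is read off from the integrals that are
  assumed to exist.\<close>

definition smooth :: "(real \<Rightarrow> real) \<Rightarrow> bool" where
  "smooth f \<longleftrightarrow> (\<forall>k x. (deriv ^^ k) f differentiable (at x))"

lemma smooth_has_derivative: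
  assumes "smooth f"
  shows "(f has_real_derivative deriv f x) (at x)"
proof -
  have "(deriv ^^ 0) f differentiable (at x)"
    using assms unfolding smooth_def by blast
  then show ?thesis
    by (simp add: DERIV_deriv_iff_real_differentiable)
qed

lemma smooth_deriv: "smooth f \<Longrightarrow> smooth (deriv f)"
  unfolding smooth_def by (metis comp_apply funpow_Suc_right)

lemma smooth_continuous_on: "smooth f \<Longrightarrow> continuous_on S f"
  by (meson DERIV_continuous_on has_field_derivative_at_within smooth_has_derivative)

text \<open>Coinduction spares all computation of iterated derivatives: it is enough to find a set
  that contains \<open>f\<close> and, with each member, a derivative of that member.\<close>

lemma smooth_coinduct:
  assumes "f \<in> S"
    and S: "\<And>g. g \<in> S \<Longrightarrow> \<exists>g'\<in>S. \<forall>x. (g has_real_derivative g' x) (at x)"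
  shows "smooth f"
proof -
  have deriv_in: "deriv g \<in> S" if g: "g \<in> S" for g
  proof -
    obtain g' where "g' \<in> S" "\<forall>x. (g has_real_derivative g' x) (at x)"
      using S[OF g] by blast
    moreover from this have "deriv g = g'"
      by (auto intro: DERIV_imp_deriv)
    ultimately show ?thesis by simp
  qed
  have iter: "(deriv ^^ k) f \<in> S" for k
    by (induction k) (auto simp: assms(1) deriv_in)
  show ?thesis
    unfolding smooth_def
    using S[OF iter] by (meson real_differentiable_def)
qed

lemma smooth_antiderivative:
  assumes "smooth f" "\<And>x. (F has_real_derivative f x) (at x)"
  shows "smooth F"
proof (rule smooth_coinduct[where S = "insert F {g. smooth g}"])
  fix g assume "g \<in> insert F {g. smooth g}"
  then have "(g = F \<and> (\<forall>x. (g has_real_derivative f x) (at x))) \<or>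
      (smooth (deriv g) \<and> (\<forall>x. (g has_real_derivative deriv g x) (at x)))"
    using assms(2) smooth_has_derivative smooth_deriv by auto
  then show "\<exists>g'\<in>insert F {g. smooth g}. \<forall>x. (g has_real_derivative g' x) (at x)"
    using assms(1) by auto
qed simp

lemma smooth_affine:
  assumes "smooth f"
  shows "smooth (\<lambda>x. f (a + b * x))"
\<comment> \<open>The factor \<open>c\<close> absorbs the powers of \<open>b\<close> that the chain
  rule produces.\<close>
proof (rule smooth_coinduct[where S = "{\<lambda>x. c * g (a + b * x) |c g. smooth g}"])
  show "(\<lambda>x. f (a + b * x)) \<in> {\<lambda>x. c * g (a + b * x) |c g. smooth g}"
    using assms by (auto intro!: exI[of _ 1])
next
  fix h assume "h \<in> {\<lambda>x. c * g (a + b * x) |c g. smooth g}"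
  then obtain c g where h: "h = (\<lambda>x. c * g (a + b * x))" and g: "smooth g" by blast
  have "(h has_real_derivative (c * b) * deriv g (a + b * x)) (at x)" for x
    unfolding h
    by (auto intro!: derivative_eq_intros DERIV_chain2[OF smooth_has_derivative[OF g]])
  then show "\<exists>h'\<in>{\<lambda>x. c * g (a + b * x) |c g. smooth g}. \<forall>x. (h has_real_derivative h' x) (at x)"
    using smooth_deriv[OF g] by (intro bexI[of _ "\<lambda>x. (c * b) * deriv g (a + b * x)"]) blast+
qed

text \<open>Products alone are not closed under differentiation, since the Leibniz rule yields a sum
  of two products; closing them under addition repairs this.\<close>

inductive_set product_span :: "(real \<Rightarrow> real) set" where
  product: "smooth f \<Longrightarrow> smooth g \<Longrightarrow> (\<lambda>x. f x * g x) \<in> product_span"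
| add: "f \<in> product_span \<Longrightarrow> g \<in> product_span \<Longrightarrow> (\<lambda>x. f x + g x) \<in> product_span"

lemma smooth_product_span:
  assumes "f \<in> product_span"
  shows "smooth f"
  using assms
proof (rule smooth_coinduct)
  fix g assume "g \<in> product_span"
  then show "\<exists>g'\<in>product_span. \<forall>x. (g has_real_derivative g' x) (at x)"
  proof induction
    case (product f g)
    then have "((\<lambda>x. f x * g x) has_real_derivative f x * deriv g x + deriv f x * g x) (at x)" for x
      by (auto intro!: derivative_eq_intros smooth_has_derivative)
    moreover have "(\<lambda>x. f x * deriv g x + deriv f x * g x) \<in> product_span"
      by (intro product_span.intros product smooth_deriv)
    ultimately show ?case
      by (intro bexI[of _ "\<lambda>x. f x * deriv g x + deriv f x * g x"] allI)
  next
    case (add f g)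
    then obtain f' g' where *: "f' \<in> product_span" "g' \<in> product_span"
      "\<And>x. (f has_real_derivative f' x) (at x)" "\<And>x. (g has_real_derivative g' x) (at x)"
      by blast
    show ?case
      by (intro bexI[of _ "\<lambda>x. f' x + g' x"] allI DERIV_add product_span.add *)
  qed
qed

lemmas smooth_mult = smooth_product_span[OF product_span.product]

lemma smooth_const: "smooth (\<lambda>_. c)"
  by (rule smooth_coinduct[where S = "range (\<lambda>c _. c)"]) (auto intro!: exI[of _ 0])

lemma smooth_diff:
  assumes "smooth f" "smooth g"
  shows "smooth (\<lambda>x. f x - g x)"
proof -
  have "(\<lambda>x. 1 * f x + (-1) * g x) \<in> product_span"
    using assms by (intro product_span.intros smooth_const)
  then show ?thesis
    using smooth_product_span by fastforce
qed

text \<open>For \<open>n = 0\<close> this is the classical smooth function exp(-1/x) that is flat at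
  0. The powers of 1/x enter because its derivatives are combinations of such powers times
  exp(-1/x).\<close>

definition flat :: "nat \<Rightarrow> real \<Rightarrow> real" where
  "flat n x = (if x > 0 then (1 / x) ^ n / exp (1 / x) else 0)"

lemma flat_has_derivative:
  "(flat n has_real_derivative (flat (n + 2) x - real n * flat (n + 1) x)) (at x)"
proof -
  consider "x < 0" | "x > 0" | "x = 0" by linarith
  then show ?thesis
  proof cases
    case 1
    have "((\<lambda>_. 0) has_real_derivative 0) (at x)" by simp
    then have "(flat n has_real_derivative 0) (at x)"
      by (rule has_field_derivative_transform_within_open[where S = "{..<0}"])
        (use 1 in \<open>auto simp: flat_def\<close>)
    then show ?thesis using 1 by (simp add: flat_def)
  next
    case 2
    have "((\<lambda>x. (1 / x) ^ n * exp (- (1 / x))) has_real_derivative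
        flat (n + 2) x - real n * flat (n + 1) x) (at x)"
      apply (rule derivative_eq_intros refl | use 2 in force)+
      using 2 by (cases n) (simp_all add: flat_def exp_minus field_simps power2_eq_square)
    then show ?thesis
      by (rule has_field_derivative_transform_within_open[where S = "{0<..}"])
        (use 2 in \<open>auto simp: flat_def exp_minus field_simps\<close>)
  next
    \<comment> \<open>At 0 the left quotient vanishes identically; the right one is y^(n+1) / exp y
      with y = 1/h tending to infinity.\<close>
    case 3
    have "((\<lambda>h. flat n h / h) \<longlongrightarrow> 0) (at_left 0)"
      by (rule tendsto_eventually)
        (auto simp: flat_def eventually_at_left_field intro!: exI[of _ "-1"])
    moreover have "((\<lambda>h. flat n h / h) \<longlongrightarrow> 0) (at_right 0)"
    proof -
      have "((\<lambda>h::real. inverse h ^ (n + 1) / exp (inverse h)) \<longlongrightarrow> 0) (at_right 0)"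
        by (rule filterlim_compose[OF tendsto_power_div_exp_0 filterlim_inverse_at_top_right])
      moreover have "\<forall>\<^sub>F h in at_right 0. inverse h ^ (n + 1) / exp (inverse h) = flat n h / h"
        by (auto simp: flat_def eventually_at_right_field field_simps intro!: exI[of _ 1])
      ultimately show ?thesis
        by (blast intro: Lim_transform_eventually)
    qed
    ultimately have "((\<lambda>h. flat n h / h) \<longlongrightarrow> 0) (at 0)"
      by (simp add: filterlim_split_at)
    then show ?thesis
      using 3 by (simp add: DERIV_def flat_def)
  qed
qed

inductive_set flat_span :: "(real \<Rightarrow> real) set" where
  flat: "flat n \<in> flat_span"
| add: "f \<in> flat_span \<Longrightarrow> g \<in> flat_span \<Longrightarrow> (\<lambda>x. f x + g x) \<in> flat_span"
| scale: "f \<in> flat_span \<Longrightarrow> (\<lambda>x. c * f x) \<in> flat_span"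

lemma smooth_flat: "smooth (flat n)"
proof (rule smooth_coinduct[OF flat_span.flat])
  fix g assume "g \<in> flat_span"
  then show "\<exists>g'\<in>flat_span. \<forall>x. (g has_real_derivative g' x) (at x)"
  proof induction
    case (flat n)
    have "(flat n has_real_derivative (flat (n + 2) x + (- real n) * flat (n + 1) x)) (at x)" for x
      using flat_has_derivative[of n x] by simp
    moreover have "(\<lambda>x. flat (n + 2) x + (- real n) * flat (n + 1) x) \<in> flat_span"
      by (intro flat_span.intros)
    ultimately show ?case
      by (intro bexI[of _ "\<lambda>x. flat (n + 2) x + (- real n) * flat (n + 1) x"] allI)
  next
    case (add f g)
    then obtain f' g' where *: "f' \<in> flat_span" "g' \<in> flat_span"
      "\<And>x. (f has_real_derivative f' x) (at x)" "\<And>x. (g has_real_derivative g' x) (at x)"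
      by blast
    show ?case
      by (intro bexI[of _ "\<lambda>x. f' x + g' x"] allI DERIV_add flat_span.add *)
  next
    case (scale f c)
    then obtain f' where *: "f' \<in> flat_span" "\<And>x. (f has_real_derivative f' x) (at x)"
      by blast
    show ?case
      by (intro bexI[of _ "\<lambda>x. c * f' x"] allI DERIV_cmult flat_span.scale *)
  qed
qed

lemma smooth_bump_exists:
  assumes "0 < d"
  obtains B where "smooth B" "\<And>x. B x > 0 \<longleftrightarrow> 0 < x \<and> x < d" "\<And>x. 0 \<le> B x"
proof
  \<comment> \<open>Both factors are written in the affine form that \<open>smooth_affine\<close>
    matches.\<close>
  show "smooth (\<lambda>x. flat 0 (0 + 1 * x) * flat 0 (d + (-1) * x))"
    by (intro smooth_mult smooth_affine smooth_flat)
qed (auto simp: flat_def)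

lemma antiderivative_exists:
  fixes f :: "real \<Rightarrow> real"
  assumes "continuous_on UNIV f"
  obtains F where "\<And>x. (F has_real_derivative f x) (at x)" "F 0 = 0"
proof
  define F where "F x = (LBINT y=0..x. f y)" for x :: real
  show "(F has_real_derivative f x) (at x)" for x
  proof -
    define a where "a = \<bar>x\<bar> + 1"
    have "(F has_vector_derivative f x) (at x within {-a..a})"
      unfolding F_def zero_ereal_def
      by (rule interval_integral_FTC2) (auto simp: a_def intro: continuous_on_subset[OF assms])
    moreover have "x \<in> interior {-a..a}"
      by (auto simp: a_def)
    ultimately show ?thesis
      unfolding has_real_derivative_iff_has_vector_derivative
      by (metis at_within_interior)
  qed
  show "F 0 = 0"
    by (simp add: F_def zero_ereal_def)
qed

text \<open>\<open>S\<close> is a primitive of the bump \<open>B\<close>. It is constant to the left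
  of 0 and to the right of \<open>d\<close>, so the difference of two translates has compact
  support; this is how a test function with a prescribed derivative is made.\<close>

lemma smooth_step_exists:
  assumes "0 < d"
  obtains S B where "smooth S" "smooth B" "\<And>x. (S has_real_derivative B x) (at x)"
    "\<And>x. B x > 0 \<longleftrightarrow> 0 < x \<and> x < d" "\<And>x. 0 \<le> B x"
    "\<And>x. x \<le> 0 \<Longrightarrow> S x = S 0" "\<And>x. d \<le> x \<Longrightarrow> S x = S d"
proof -
  obtain B where B: "smooth B" "\<And>x. B x > 0 \<longleftrightarrow> 0 < x \<and> x < d" "\<And>x. 0 \<le> B x"
    using smooth_bump_exists[OF assms] by blast
  obtain S where S: "\<And>x. (S has_real_derivative B x) (at x)"
    using antiderivative_exists smooth_continuous_on[OF B(1)] by metis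
  have B0: "B x = 0" if "x \<le> 0 \<or> d \<le> x" for x
    using B(2,3)[of x] that by linarith
  have const: "S x = S y" if less: "x < y" and y: "y \<le> 0 \<or> d \<le> x" for x y
  proof -
    obtain z where "x < z" "z < y" "S y - S x = (y - x) * B z"
      using MVT2[OF less S] by blast
    then show ?thesis using B0[of z] y by auto
  qed
  show thesis
  proof (rule that)
    show "smooth S"
      by (rule smooth_antiderivative[OF B(1) S])
    show "S x = S 0" if "x \<le> 0" for x
      using const[of x 0] that by fastforce
    show "S x = S d" if "d \<le> x" for x
      using const[of d x] that by fastforce
  qed (use B S in auto)
qed

section \<open>Test functions and the lemma of du Bois-Reymond\<close>

lemma test_function_iff:
  "test_function T \<psi> \<longleftrightarrow> smooth \<psi> \<and> compact (closure {x. \<psi> x \<noteq> 0}) \<and> closure {x. \<psi> x \<noteq> 0} \<subseteq> {0<..<T}"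
  by (simp add: test_function_def smooth_def)

lemma test_function_zero:
  assumes "test_function T \<psi>" "x \<notin> {0<..<T}"
  shows "\<psi> x = 0"
  using assms closure_subset[of "{x. \<psi> x \<noteq> 0}"] by (auto simp: test_function_def)

lemma test_functionI:
  assumes "smooth \<psi>" "0 < a" "b < T" "\<And>x. x \<notin> {a..b} \<Longrightarrow> \<psi> x = 0"
  shows "test_function T \<psi>"
proof -
  have "closure {x. \<psi> x \<noteq> 0} \<subseteq> {a..b}"
    using assms(4) by (intro closure_minimal) blast+
  moreover from this have "compact (closure {x. \<psi> x \<noteq> 0})"
    by (meson compact_Icc bounded_subset closed_closure compact_eq_bounded_closed)
  ultimately show ?thesis
    using assms by (auto simp: test_function_iff)
qed

lemma
  fixes f :: "real \<Rightarrow> real"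
  assumes "continuous_on {0..T} f"
  shows integrable_lebesgue_on_Ioo: "integrable (lebesgue_on {0<..<T}) f"
    and integral_lebesgue_on_Ioo: "(LINT t|lebesgue_on {0<..<T}. f t) = integral {0..T} f"
proof -
  have "f absolutely_integrable_on {0..T}"
    using assms by (rule absolutely_integrable_continuous_real)
  then have "f absolutely_integrable_on {0<..<T}"
    by (rule set_integrable_subset) auto
  then show *: "integrable (lebesgue_on {0<..<T}) f"
    by (simp add: integrable_restrict_space set_integrable_def)
  show "(LINT t|lebesgue_on {0<..<T}. f t) = integral {0..T} f"
    using lebesgue_integral_eq_integral[OF *]
    by (simp add: integral_open_interval_real)
qed

lemma integral_deriv_test_function:
  assumes "test_function T \<psi>" "0 \<le> T"
  shows "(LINT t|lebesgue_on {0<..<T}. deriv \<psi> t) = 0"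
proof -
  have \<psi>: "smooth \<psi>" using assms by (simp add: test_function_iff)
  have "(deriv \<psi> has_integral (\<psi> T - \<psi> 0)) {0..T}"
    using assms(2) smooth_has_derivative[OF \<psi>]
    by (intro fundamental_theorem_of_calculus)
      (auto simp flip: has_real_derivative_iff_has_vector_derivative intro: has_field_derivative_at_within)
  then show ?thesis
    using test_function_zero[OF assms(1), of 0] test_function_zero[OF assms(1), of T]
    by (simp add: integral_lebesgue_on_Ioo smooth_continuous_on smooth_deriv \<psi> integral_unique)
qed

text \<open>Derivatives of test functions have integral zero, so \<open>u\<close> may be shifted by
  any constant \<open>m\<close>. With \<open>m\<close> between \<open>u a\<close> and
  \<open>u b\<close>, a test function that changes just after \<open>a\<close> and just after
  \<open>b\<close> makes \<open>deriv \<psi> t * (m - u t)\<close> nonnegative, and nonzero on an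
  interval, against its vanishing integral. The order of \<open>a\<close> and \<open>b\<close> on
  the line is left open.\<close>

lemma du_Bois_Reymond_less:
  assumes u: "continuous_on {0..T} u" and ab: "a \<in> {0<..<T}" "b \<in> {0<..<T}"
    and orth: "\<And>\<psi>. test_function T \<psi> \<Longrightarrow> (LINT t|lebesgue_on {0<..<T}. deriv \<psi> t * u t) = 0"
  shows "\<not> u a < u b"
proof
  assume less: "u a < u b"
  define m where "m = (u a + u b) / 2"
  have "isCont u a" "isCont u b"
    using continuous_on_interior[OF u] ab by auto
  moreover have "u a < m" "m < u b"
    using less by (auto simp: m_def)
  ultimately have "\<forall>\<^sub>F x in at a. u x < m" "\<forall>\<^sub>F x in at b. u x > m"
    by (auto simp: isCont_def intro: order_tendstoD)
  then obtain d1 d2 where d1: "d1 > 0" "\<And>x. x \<noteq> a \<Longrightarrow> dist x a < d1 \<Longrightarrow> u x < m"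
    and d2: "d2 > 0" "\<And>x. x \<noteq> b \<Longrightarrow> dist x b < d2 \<Longrightarrow> u x > m"
    unfolding eventually_at by blast
  \<comment> \<open>Small enough that \<open>u < m\<close> on (a, a+d), \<open>m < u\<close> on (b,
    b+d) and both intervals end before \<open>T\<close>; halving makes the inequalities
    strict.\<close>
  define d where "d = min (min d1 d2) (min (T - a) (T - b)) / 2"
  have d: "0 < d" "d < d1" "d < d2" "a + d < T" "b + d < T"
    using d1 d2 ab by (auto simp: d_def min_def field_simps)
  obtain S B where SB: "smooth S" "smooth B" "\<And>x. (S has_real_derivative B x) (at x)"
    and B: "\<And>x. B x > 0 \<longleftrightarrow> 0 < x \<and> x < d" "\<And>x. 0 \<le> B x"
    and S: "\<And>x. x \<le> 0 \<Longrightarrow> S x = S 0" "\<And>x. d \<le> x \<Longrightarrow> S x = S d"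
    using smooth_step_exists[OF d(1)] by blast
  have B0: "B x = 0" if "x \<le> 0 \<or> d \<le> x" for x
    using B[of x] that by linarith
  \<comment> \<open>The derivative of \<open>\<psi>\<close> is a bump where \<open>u < m\<close> minus a bump where \<open>m < u\<close>.\<close>
  define \<psi> where "\<psi> x = S (- a + 1 * x) - S (- b + 1 * x)" for x
  have smooth: "smooth \<psi>"
    unfolding \<psi>_def by (intro smooth_diff smooth_affine SB)
  have test: "test_function T \<psi>"
  proof (rule test_functionI[OF smooth])
    show "0 < min a b" "max a b + d < T" using ab d by auto
    show "\<psi> x = 0" if "x \<notin> {min a b..max a b + d}" for x
    proof -
      have "x \<le> min a b \<or> max a b + d \<le> x" using that by auto
      then show ?thesis
        using S(1)[of "x - a"] S(1)[of "x - b"] S(2)[of "x - a"] S(2)[of "x - b"]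
        by (auto simp: \<psi>_def)
    qed
  qed
  have "(\<psi> has_real_derivative B (x - a) - B (x - b)) (at x)" for x
    unfolding \<psi>_def by (auto intro!: derivative_eq_intros DERIV_chain2[OF SB(3)])
  then have deriv: "deriv \<psi> x = B (x - a) - B (x - b)" for x
    by (rule DERIV_imp_deriv)
  have cont: "continuous_on {0..T} (deriv \<psi>)"
    by (intro smooth_continuous_on smooth_deriv smooth)
  have nonneg: "0 \<le> deriv \<psi> x * (m - u x)" for x
  proof -
    have "0 \<le> B (x - a) * (m - u x)"
    proof (cases "0 < x - a \<and> x - a < d")
      case True
      then show ?thesis using B(2)[of "x - a"] d1(2)[of x] d by (intro mult_nonneg_nonneg) (auto simp: dist_real_def)
    qed (auto simp: B0)
    moreover have "0 \<le> B (x - b) * (u x - m)"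
    proof (cases "0 < x - b \<and> x - b < d")
      case True
      then show ?thesis using B(2)[of "x - b"] d2(2)[of x] d by (intro mult_nonneg_nonneg) (auto simp: dist_real_def)
    qed (auto simp: B0)
    ultimately show ?thesis by (simp add: deriv algebra_simps)
  qed
  have int: "integrable (lebesgue_on {0<..<T}) (\<lambda>t. deriv \<psi> t * (m - u t))"
    by (intro integrable_lebesgue_on_Ioo continuous_intros cont u)
  have "(LINT t|lebesgue_on {0<..<T}. deriv \<psi> t * (m - u t)) =
      (LINT t|lebesgue_on {0<..<T}. deriv \<psi> t * m) - (LINT t|lebesgue_on {0<..<T}. deriv \<psi> t * u t)"
    unfolding right_diff_distrib
    by (intro Bochner_Integration.integral_diff integrable_lebesgue_on_Ioo continuous_intros cont u)
  also have "\<dots> = 0"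
    using ab orth[OF test] integral_deriv_test_function[OF test] by simp
  finally have "AE t in lebesgue_on {0<..<T}. deriv \<psi> t * (m - u t) = 0"
    using integral_nonneg_eq_0_iff_AE[OF int] nonneg by simp
  then have "AE t in lebesgue. t \<in> {0<..<T} \<longrightarrow> deriv \<psi> t * (m - u t) = 0"
    by (simp add: AE_restrict_space_iff)
  \<comment> \<open>The two bumps cannot overlap: \<open>u < m\<close> where the first one lives,
    \<open>m < u\<close> where the second one lives.\<close>
  moreover have "deriv \<psi> t * (m - u t) \<noteq> 0" if "t \<in> {a<..<a + d}" for t
  proof -
    have "u t < m" using that d1(2)[of t] d by (auto simp: dist_real_def)
    then have "\<not> (b < t \<and> t < b + d)" using d2(2)[of t] d by (fastforce simp: dist_real_def)
    then have "B (t - b) = 0" by (intro B0) auto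
    moreover have "B (t - a) > 0" using that by (simp add: B)
    ultimately show ?thesis using \<open>u t < m\<close> by (simp add: deriv)
  qed
  ultimately have "AE t in lebesgue. t \<notin> {a<..<a + d}"
    using ab d by (auto elim!: eventually_mono)
  then have "{a<..<a + d} \<in> null_sets lebesgue"
    by (subst (asm) AE_iff_null_sets[symmetric]) auto
  then show False
    using d by (auto simp: null_sets_def)
qed

lemma du_Bois_Reymond:
  assumes "continuous_on {0..T} u" "a \<in> {0<..<T}" "b \<in> {0<..<T}"
    and "\<And>\<psi>. test_function T \<psi> \<Longrightarrow> (LINT t|lebesgue_on {0<..<T}. deriv \<psi> t * u t) = 0"
  shows "u a = u b"
  using du_Bois_Reymond_less[OF assms] du_Bois_Reymond_less[OF assms(1,3,2,4)] by force

subsection \<open>Convolution with the Riemann--Liouville kernel\<close>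

text \<open>Since \<open>0 powr x = 0\<close> for every exponent, \<open>max 0 u\<close> cuts the
  kernel off at 0 even for \<open>a = 1\<close>, where it becomes the indicator of the positive
  half-line.\<close>

definition rl_kernel :: "real \<Rightarrow> real \<Rightarrow> real" where
  "rl_kernel a u = max 0 u powr (a - 1)"

text \<open>For \<open>g\<close> supported in (0,T) this is Gamma(a) times the Riemann--Liouville
  integral of order \<open>a\<close>; without the factor 1/Gamma(a) the composition law involves
  just the Beta function. Where the integrand is not integrable, the value is 0.\<close>

definition rl_conv :: "real \<Rightarrow> (real \<Rightarrow> real) \<Rightarrow> real \<Rightarrow> real" where
  "rl_conv a g t = (LINT s|lborel. rl_kernel a (t - s) * g s)"

lemma rl_kernel_measurable [measurable]: "rl_kernel a \<in> borel_measurable borel"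
  unfolding rl_kernel_def by measurable

lemma rl_kernel_nonneg [simp]: "0 \<le> rl_kernel a u"
  by (simp add: rl_kernel_def)

lemma rl_kernel_nonpos [simp]: "u \<le> 0 \<Longrightarrow> rl_kernel a u = 0"
  by (simp add: rl_kernel_def)

lemma rl_kernel_pos: "0 < u \<Longrightarrow> rl_kernel a u = u powr (a - 1)"
  by (simp add: rl_kernel_def)

lemma rl_conv_measurable [measurable]:
  assumes [measurable]: "g \<in> borel_measurable borel"
  shows "rl_conv a g \<in> borel_measurable borel"
  unfolding rl_conv_def by measurable

lemma rl_conv_nonpos:
  assumes "\<And>s. s \<le> 0 \<Longrightarrow> g s = 0" "t \<le> 0"
  shows "rl_conv a g t = 0"
proof -
  have "rl_kernel a (t - s) * g s = 0" for s
    using assms by (cases "s \<le> 0") auto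
  then show ?thesis unfolding rl_conv_def by (simp only: Bochner_Integration.integral_zero)
qed

lemma rl_conv_cong:
  assumes "\<And>s. s < t \<Longrightarrow> g s = h s"
  shows "rl_conv a g t = rl_conv a h t"
  unfolding rl_conv_def
proof (rule Bochner_Integration.integral_cong)
  show "rl_kernel a (t - s) * g s = rl_kernel a (t - s) * h s" for s
    using assms by (cases "s < t") auto
qed simp

lemma Beta_real_nonneg: "0 < a \<Longrightarrow> 0 < b \<Longrightarrow> 0 \<le> Beta a (b :: real)"
  by (simp add: Beta_def Gamma_real_pos less_imp_le)

lemma nn_integral_rl_kernel:
  assumes "0 < a" "0 \<le> d"
  shows "(\<integral>\<^sup>+u. ennreal (rl_kernel a u * indicator {..d} u) \<partial>lborel) = ennreal (d powr a / a)"
proof -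
  have "((\<lambda>u. u powr (a - 1)) has_integral d powr a / a) {0..d}"
    using has_integral_powr_from_0[of "a - 1" d] assms by simp
  then have "(\<integral>\<^sup>+u. indicator {0..d} u * u powr (a - 1) \<partial>lborel) = ennreal (d powr a / a)"
    by (rule nn_integral_has_integral_lebesgue[rotated]) simp
  moreover have "indicator {0..d} u * u powr (a - 1) = rl_kernel a u * indicator {..d} u" for u
    by (cases "u \<le> 0") (auto simp: indicator_def rl_kernel_pos split: if_splits)
  ultimately show ?thesis by simp
qed

text \<open>The substitution s = r + d x with d = t - r maps the unit interval to the one between
  \<open>r\<close> and \<open>t\<close>. Homogeneity of the kernels pulls out d^(a-1) d^(b-1), the
  Jacobian gives d, and the Beta integral remains.\<close>

lemma nn_integral_rl_kernel_Beta:
  assumes a: "0 < a" and b: "0 < b"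
  shows "(\<integral>\<^sup>+s. ennreal (rl_kernel a (t - s) * rl_kernel b (s - r)) \<partial>lborel) =
    ennreal (Beta a b * rl_kernel (a + b) (t - r))"
proof (cases "r < t")
  case False
  have "rl_kernel a (t - s) * rl_kernel b (s - r) = 0" for s
    using False by (cases "s \<le> r") auto
  then show ?thesis using False by (simp only: ennreal_0) simp
next
  case True
  define d where "d = t - r"
  have d: "0 < d" using True by (simp add: d_def)
  have "(\<integral>\<^sup>+x. indicator {0..1} x * (x powr (b - 1) * (1 - x) powr (a - 1)) \<partial>lborel) = ennreal (Beta b a)"
    by (rule nn_integral_has_integral_lebesgue[OF _ has_integral_Beta_real[OF b a]]) simp
  moreover have "indicator {0..1} x * (x powr (b - 1) * (1 - x) powr (a - 1)) =
      rl_kernel a (1 - x) * rl_kernel b x" for x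
    by (auto simp: indicator_def rl_kernel_def max_def)
  ultimately have B: "(\<integral>\<^sup>+x. ennreal (rl_kernel a (1 - x) * rl_kernel b x) \<partial>lborel) = ennreal (Beta a b)"
    by (simp add: Beta_commute)
  have scale: "rl_kernel c (d * x) = d powr (c - 1) * rl_kernel c x" for c x
    using d by (cases "x \<le> 0") (auto simp: rl_kernel_pos powr_mult mult_le_0_iff)
  have sc: "rl_kernel a (t - (r + d * x)) * rl_kernel b ((r + d * x) - r) =
      d powr (a - 1) * d powr (b - 1) * (rl_kernel a (1 - x) * rl_kernel b x)" for x
    using scale[of a "1 - x"] scale[of b x] by (simp add: d_def algebra_simps)
  have "(\<integral>\<^sup>+s. ennreal (rl_kernel a (t - s) * rl_kernel b (s - r)) \<partial>lborel) =
      ennreal \<bar>d\<bar> * (\<integral>\<^sup>+x. ennreal (rl_kernel a (t - (r + d * x)) * rl_kernel b ((r + d * x) - r)) \<partial>lborel)"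
    using d by (intro nn_integral_real_affine) auto
  also have "\<dots> = ennreal d * (ennreal (d powr (a - 1) * d powr (b - 1)) * ennreal (Beta a b))"
    unfolding sc B[symmetric] using d
    by (subst nn_integral_cmult[symmetric]) (auto simp: ennreal_mult')
  also have "\<dots> = ennreal (Beta a b * (d * (d powr (a - 1) * d powr (b - 1))))"
    using d by (simp add: ennreal_mult[symmetric] Beta_real_nonneg a b mult.commute mult.assoc less_imp_le)
  also have "d * (d powr (a - 1) * d powr (b - 1)) = rl_kernel (a + b) (t - r)"
    using d True by (simp add: rl_kernel_pos flip: powr_add d_def) (simp add: powr_mult_base)
  finally show ?thesis .
qed

text \<open>The semigroup law of fractional integration. Integrating the absolute value of the
  double integrand in \<open>s\<close> first gives a multiple of the kernel of order
  \<open>a + b\<close> times |g|, so integrability at that order, at the single point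
  \<open>t\<close>, is what Fubini requires.\<close>

lemma
  assumes a: "0 < a" and b: "0 < b"
    and g [measurable]: "g \<in> borel_measurable borel"
    and int: "integrable lborel (\<lambda>r. rl_kernel (a + b) (t - r) * g r)"
  shows rl_conv_rl_conv: "rl_conv a (rl_conv b g) t = Beta a b * rl_conv (a + b) g t"
    and integrable_rl_conv_rl_conv: "integrable lborel (\<lambda>s. rl_kernel a (t - s) * rl_conv b g s)"
proof -
  define F where "F = (\<lambda>(r, s). rl_kernel a (t - s) * rl_kernel b (s - r) * g r)"
  have [measurable]: "F \<in> borel_measurable (lborel \<Otimes>\<^sub>M lborel)"
    unfolding F_def by measurable
  have inner: "has_bochner_integral lborel (\<lambda>s. rl_kernel a (t - s) * rl_kernel b (s - r))
      (Beta a b * rl_kernel (a + b) (t - r))" for r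
    using nn_integral_rl_kernel_Beta[OF a b] Beta_real_nonneg[OF a b]
    by (intro has_bochner_integral_nn_integral) auto
  have intF: "integrable (lborel \<Otimes>\<^sub>M lborel) F"
  proof (rule lborel_pair.Fubini_integrable)
    have "norm (F (r, s)) = rl_kernel a (t - s) * rl_kernel b (s - r) * \<bar>g r\<bar>" for r s
      by (simp add: F_def abs_mult)
    then have "(\<lambda>r. LINT s|lborel. norm (F (r, s))) =
        (\<lambda>r. Beta a b * norm (rl_kernel (a + b) (t - r) * g r))"
      using inner[THEN has_bochner_integral_integral_eq] by (simp add: abs_mult fun_eq_iff)
    then show "integrable lborel (\<lambda>r. LINT s|lborel. norm (F (r, s)))"
      using int by simp
    show "AE r in lborel. integrable lborel (\<lambda>s. F (r, s))"
      using inner[THEN integrable.intros] by (simp add: F_def)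
  qed measurable
  \<comment> \<open>Valid for all \<open>s\<close>, even where the inner integrand is not
    integrable: with default value 0, constant factors can always be pulled out.\<close>
  have eq: "(LINT r|lborel. F (r, s)) = rl_kernel a (t - s) * rl_conv b g s" for s
    by (simp add: F_def rl_conv_def mult.assoc)
  have "(LINT s|lborel. LINT r|lborel. F (r, s)) = (LINT r|lborel. LINT s|lborel. F (r, s))"
    using lborel_pair.Fubini_integral[of "\<lambda>r s. F (r, s)"] intF by simp
  also have "\<dots> = (LINT r|lborel. Beta a b * rl_kernel (a + b) (t - r) * g r)"
    using inner[THEN has_bochner_integral_integral_eq] by (simp add: F_def)
  also have "\<dots> = Beta a b * rl_conv (a + b) g t"
    by (simp add: rl_conv_def mult.assoc)
  finally show "rl_conv a (rl_conv b g) t = Beta a b * rl_conv (a + b) g t"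
    by (simp add: eq rl_conv_def[of a])
  show "integrable lborel (\<lambda>s. rl_kernel a (t - s) * rl_conv b g s)"
    using lborel_pair.integrable_snd[of "\<lambda>r s. F (r, s)"] intF by (simp add: eq)
qed

text \<open>Tonelli: for fixed \<open>s\<close> in (0,T) the \<open>t\<close>-integral of the kernel
  over (0,T) is at most T^a / a, uniformly in \<open>s\<close>. Hence fractional integration maps
  L^1 to L^1; the joint integrability is kept for a later exchange of integrals.\<close>

lemma
  assumes a: "0 < a" and T: "0 \<le> T" and g: "integrable lborel g"
    and g0: "\<And>s. s \<notin> {0<..<T} \<Longrightarrow> g s = 0"
  shows integrable_pair_rl_kernel: "integrable (lborel \<Otimes>\<^sub>M lborel)
      (\<lambda>(s, t). indicator {0<..<T} t * rl_kernel a (t - s) * g s)" (is ?pair)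
    and integrable_rl_conv: "integrable lborel (\<lambda>t. indicator {0<..<T} t * rl_conv a g t)"
proof -
  have [measurable]: "g \<in> borel_measurable borel" using g by simp
  define F where "F = (\<lambda>(s, t). indicator {0<..<T} t * rl_kernel a (t - s) * g s)"
  have [measurable]: "F \<in> borel_measurable (lborel \<Otimes>\<^sub>M lborel)"
    unfolding F_def by measurable
  have intF: "integrable (lborel \<Otimes>\<^sub>M lborel) F"
  proof (rule integrableI_bounded)
    have "(\<integral>\<^sup>+x. ennreal (norm (F x)) \<partial>(lborel \<Otimes>\<^sub>M lborel)) =
        (\<integral>\<^sup>+s. \<integral>\<^sup>+t. ennreal (norm (F (s, t))) \<partial>lborel \<partial>lborel)"
      by (rule lborel.nn_integral_fst[symmetric]) measurable
    also have "\<dots> \<le> (\<integral>\<^sup>+s. ennreal (T powr a / a) * ennreal (norm (g s)) \<partial>lborel)"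
    proof (rule nn_integral_mono)
      fix s
      have "(\<integral>\<^sup>+t. ennreal (norm (F (s, t))) \<partial>lborel) \<le>
          (\<integral>\<^sup>+t. ennreal (rl_kernel a (t - s) * indicator {..T} (t - s)) * ennreal (norm (g s)) \<partial>lborel)"
        using g0[of s]
        by (intro nn_integral_mono) (auto simp: F_def indicator_def abs_mult simp flip: ennreal_mult')
      also have "\<dots> = (\<integral>\<^sup>+t. ennreal (rl_kernel a (t - s) * indicator {..T} (t - s)) \<partial>lborel) * ennreal (norm (g s))"
        by (rule nn_integral_multc) measurable
      also have "(\<integral>\<^sup>+t. ennreal (rl_kernel a (t - s) * indicator {..T} (t - s)) \<partial>lborel) = ennreal (T powr a / a)"
        using nn_integral_real_affine[of "\<lambda>u. ennreal (rl_kernel a u * indicator {..T} u)" 1 "- s"]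
          nn_integral_rl_kernel[OF a T] by simp
      finally show "(\<integral>\<^sup>+t. ennreal (norm (F (s, t))) \<partial>lborel) \<le> ennreal (T powr a / a) * ennreal (norm (g s))" .
    qed
    also have "\<dots> = ennreal (T powr a / a) * (\<integral>\<^sup>+s. ennreal (norm (g s)) \<partial>lborel)"
      by (rule nn_integral_cmult) measurable
    also have "\<dots> < \<infinity>"
      using g by (auto simp: integrable_iff_bounded ennreal_mult_less_top)
    finally show "(\<integral>\<^sup>+x. ennreal (norm (F x)) \<partial>(lborel \<Otimes>\<^sub>M lborel)) < \<infinity>" .
  qed measurable
  then show ?pair by (simp only: F_def)
  have "integrable lborel (\<lambda>t. LINT s|lborel. F (s, t))"
    using lborel_pair.integrable_snd[of "\<lambda>s t. F (s, t)"] intF by simp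
  then show "integrable lborel (\<lambda>t. indicator {0<..<T} t * rl_conv a g t)"
    by (simp add: F_def rl_conv_def mult.assoc)
qed

text \<open>A substitute for Hoelder's inequality: the weight \<open>c\<close> can be chosen to make
  the L^p term small, while the other term is made small by shrinking the domain. The factors 1/p
  and 1/q of Young's inequality are dropped.\<close>

lemma Youngs_inequality_scaled:
  fixes p c x y :: real
  assumes "1 < p" "0 < c" "0 \<le> x" "0 \<le> y"
  shows "x * y \<le> c powr - (p / (p - 1)) * x powr (p / (p - 1)) + c powr p * y powr p"
proof -
  define q where "q = p / (p - 1)"
  have q: "1 < q" "1 / q + 1 / p = 1"
    using assms(1) by (auto simp: q_def field_simps)
  have "x * y = (x / c) * (c * y)"
    using assms by simp
  also have "\<dots> \<le> (x / c) powr q / q + (c * y) powr p / p"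
    using assms q by (intro Youngs_inequality) auto
  also have "\<dots> \<le> (x / c) powr q + (c * y) powr p"
    using q assms(1) by (intro add_mono) (auto simp: divide_le_eq mult_le_cancel_left1)
  also have "\<dots> = c powr - q * x powr q + c powr p * y powr p"
    using assms by (simp add: powr_divide powr_mult powr_minus_divide)
  finally show ?thesis by (simp add: q_def)
qed

text \<open>A bounded continuous minorant of \<open>rl_kernel a\<close> that agrees with it on \<open>{d..}\<close>.\<close>

definition rl_trunc :: "real \<Rightarrow> real \<Rightarrow> real \<Rightarrow> real" where
  "rl_trunc a d u = max 0 u powr a / max u d"

section \<open>Continuity of fractional integrals of L^p densities\<close>

locale Lp_density =
  fixes a p T :: real and g :: "real \<Rightarrow> real"
  assumes a: "0 < a" "a \<le> 1" and p: "1 < p" "1 / a < p"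
    and g_measurable [measurable]: "g \<in> borel_measurable borel"
    and integrable_powr: "integrable lborel (\<lambda>s. \<bar>g s\<bar> powr p)"
    and g_zero: "\<And>s. s \<notin> {0<..<T} \<Longrightarrow> g s = 0"
begin

lemma integrable_density: "integrable lborel g"
proof (rule Bochner_Integration.integrable_bound)
  have "emeasure lborel {0<..<T} < \<infinity>"
    by (cases "0 \<le> T") auto
  then show "integrable lborel (\<lambda>s. indicator {0<..<T} s + \<bar>g s\<bar> powr p)"
    using integrable_powr
    by (intro Bochner_Integration.integrable_add integrable_real_indicator) auto
  have "\<bar>g s\<bar> \<le> indicator {0<..<T} s + \<bar>g s\<bar> powr p" for s
  proof (cases "\<bar>g s\<bar> \<le> 1")
    case True
    then show ?thesis
      using g_zero[of s] by (cases "s \<in> {0<..<T}") (auto intro!: add_increasing2)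
  next
    case False
    then have "\<bar>g s\<bar> powr 1 \<le> \<bar>g s\<bar> powr p"
      using p by (intro powr_mono) auto
    then show ?thesis using False by (auto simp: indicator_def)
  qed
  then show "AE s in lborel. norm (g s) \<le> norm (indicator {0<..<T} s + \<bar>g s\<bar> powr p :: real)"
    by (intro AE_I2) (simp add: order_trans[OF _ abs_ge_self])
qed measurable

text \<open>\<open>q\<close> is the exponent conjugate to \<open>p\<close>, and \<open>b\<close> the order with \<open>rl_kernel a u powr q = rl_kernel b u\<close>.\<close>

definition "q = p / (p - 1)"
definition "b = (a - 1) * q + 1"

text \<open>The hypothesis \<open>1 / a < p\<close> enters here, through
  \<open>b = (a * p - 1) / (p - 1)\<close>. It makes the q-th power of the kernel integrable at
  0.\<close>

lemma b_pos: "0 < b"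
proof -
  have "b = (a * p - 1) / (p - 1)"
    using p by (simp add: b_def q_def field_simps)
  moreover have "0 < a * p - 1" using p a by (simp add: field_simps)
  ultimately show ?thesis using p by simp
qed

text \<open>Young's inequality under the integral. The bound does not depend on \<open>t\<close>,
  which makes the later approximation uniform.\<close>

lemma nn_integral_rl_kernel_mult_le:
  assumes "0 < c" "0 \<le> d"
  shows "(\<integral>\<^sup>+s. ennreal (rl_kernel a (t - s) * \<bar>g s\<bar> * indicator {..d} (t - s)) \<partial>lborel)
    \<le> ennreal (c powr - q * (d powr b / b) + c powr p * (LINT s|lborel. \<bar>g s\<bar> powr p))"
proof -
  have powr_kernel: "rl_kernel a u powr q = rl_kernel b u" for u
    by (simp add: rl_kernel_def powr_powr b_def)
  have "(\<integral>\<^sup>+s. ennreal (rl_kernel a (t - s) * \<bar>g s\<bar> * indicator {..d} (t - s)) \<partial>lborel) \<le>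
      (\<integral>\<^sup>+s. ennreal (c powr - q) * ennreal (rl_kernel b (t - s) * indicator {..d} (t - s)) +
        ennreal (c powr p) * ennreal (\<bar>g s\<bar> powr p) \<partial>lborel)"
  proof (rule nn_integral_mono)
    fix s
    have "rl_kernel a (t - s) * \<bar>g s\<bar> \<le> c powr - q * rl_kernel b (t - s) + c powr p * \<bar>g s\<bar> powr p"
      using Youngs_inequality_scaled[OF p(1) assms(1), of "rl_kernel a (t - s)" "\<bar>g s\<bar>"]
      by (simp add: powr_kernel flip: q_def)
    then have "rl_kernel a (t - s) * \<bar>g s\<bar> * indicator {..d} (t - s) \<le>
        c powr - q * (rl_kernel b (t - s) * indicator {..d} (t - s)) + c powr p * \<bar>g s\<bar> powr p"
      by (auto simp: indicator_def)
    then show "ennreal (rl_kernel a (t - s) * \<bar>g s\<bar> * indicator {..d} (t - s)) \<le>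
        ennreal (c powr - q) * ennreal (rl_kernel b (t - s) * indicator {..d} (t - s)) +
        ennreal (c powr p) * ennreal (\<bar>g s\<bar> powr p)"
      by (simp flip: ennreal_mult ennreal_plus)
  qed
  also have "\<dots> = ennreal (c powr - q) * (\<integral>\<^sup>+s. ennreal (rl_kernel b (t - s) * indicator {..d} (t - s)) \<partial>lborel) +
      ennreal (c powr p) * (\<integral>\<^sup>+s. ennreal (\<bar>g s\<bar> powr p) \<partial>lborel)"
    by (subst nn_integral_add) (auto simp: nn_integral_cmult)
  also have "(\<integral>\<^sup>+s. ennreal (rl_kernel b (t - s) * indicator {..d} (t - s)) \<partial>lborel) = ennreal (d powr b / b)"
    using nn_integral_real_affine[of "\<lambda>u. ennreal (rl_kernel b u * indicator {..d} u)" "-1" t]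
      nn_integral_rl_kernel[OF b_pos assms(2)] by simp
  also have "(\<integral>\<^sup>+s. ennreal (\<bar>g s\<bar> powr p) \<partial>lborel) = ennreal (LINT s|lborel. \<bar>g s\<bar> powr p)"
    by (rule nn_integral_eq_integral[OF integrable_powr]) simp
  finally show ?thesis
    using b_pos by (simp flip: ennreal_mult ennreal_plus)
qed

lemma nn_integral_rl_kernel_small:
  assumes "0 < e"
  obtains d where "0 < d"
    "\<And>t. (\<integral>\<^sup>+s. ennreal (rl_kernel a (t - s) * \<bar>g s\<bar> * indicator {..d} (t - s)) \<partial>lborel) \<le> ennreal e"
proof -
  define N where "N = (LINT s|lborel. \<bar>g s\<bar> powr p)"
  have N: "0 \<le> N" by (simp add: N_def)
  \<comment> \<open>Makes c^p N at most e/2; \<open>N + 1\<close> avoids a division by zero.\<close>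
  define c where "c = (e / (2 * (N + 1))) powr (1 / p)"
  have c: "0 < c" using assms N by (simp add: c_def)
  have "c powr p = e / (2 * (N + 1))"
    using assms N p by (simp add: c_def powr_powr)
  then have "c powr p * N = e / 2 * (N / (N + 1))"
    by simp
  also have "\<dots> \<le> e / 2"
    using assms N by (intro mult_left_le) auto
  finally have cN: "c powr p * N \<le> e / 2" .
  \<comment> \<open>With \<open>c\<close> fixed, this solves c^(-q) d^b / b = e/2.\<close>
  define d where "d = (e / 2 * b * c powr q) powr (1 / b)"
  have d: "0 < d" using assms b_pos c by (simp add: d_def)
  have "d powr b = e / 2 * b * c powr q"
    using assms b_pos c unfolding d_def powr_powr by (simp add: less_imp_le)
  then have "c powr - q * (d powr b / b) = e / 2"
    using b_pos c by (simp add: powr_minus field_simps)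
  then have "c powr - q * (d powr b / b) + c powr p * N \<le> e"
    using cN by simp
  then have "ennreal (c powr - q * (d powr b / b) + c powr p * (LINT s|lborel. \<bar>g s\<bar> powr p)) \<le> ennreal e"
    unfolding N_def by (rule ennreal_leI)
  then show thesis
    using d by (intro that[OF d] order_trans[OF nn_integral_rl_kernel_mult_le[OF c]]) auto
qed

lemma nn_integral_rl_kernel_bound:
  assumes "t \<le> R" "0 \<le> R"
  shows "(\<integral>\<^sup>+s. ennreal (rl_kernel a (t - s) * \<bar>g s\<bar>) \<partial>lborel)
    \<le> ennreal (R powr b / b + (LINT s|lborel. \<bar>g s\<bar> powr p))"
proof -
  \<comment> \<open>The density lives on positive \<open>s\<close>, where t - s < R.\<close>
  have "rl_kernel a (t - s) * \<bar>g s\<bar> = rl_kernel a (t - s) * \<bar>g s\<bar> * indicator {..R} (t - s)" for s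
    using assms g_zero[of s] by (auto simp: indicator_def)
  then have "(\<integral>\<^sup>+s. ennreal (rl_kernel a (t - s) * \<bar>g s\<bar>) \<partial>lborel) =
      (\<integral>\<^sup>+s. ennreal (rl_kernel a (t - s) * \<bar>g s\<bar> * indicator {..R} (t - s)) \<partial>lborel)"
    by (intro nn_integral_cong) (rule arg_cong)
  then show ?thesis
    using nn_integral_rl_kernel_mult_le[of 1 R t] assms by simp
qed

lemma integrable_rl_kernel_mult: "integrable lborel (\<lambda>s. rl_kernel a (t - s) * g s)"
proof (rule integrableI_bounded)
  have "(\<integral>\<^sup>+s. ennreal (norm (rl_kernel a (t - s) * g s)) \<partial>lborel) < top"
    using order.strict_trans1[OF nn_integral_rl_kernel_bound[of t "\<bar>t\<bar>"] ennreal_less_top]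
    by (simp add: abs_mult)
  then show "(\<integral>\<^sup>+s. ennreal (norm (rl_kernel a (t - s) * g s)) \<partial>lborel) < \<infinity>"
    by simp
qed measurable

lemma continuous_rl_trunc_conv:
  assumes d: "0 < d"
  shows "continuous_on UNIV (\<lambda>t. LINT s|lborel. rl_trunc a d (t - s) * g s)"
proof -
  have cont: "continuous_on UNIV (rl_trunc a d)"
    unfolding rl_trunc_def using d a by (auto intro!: continuous_intros continuous_on_powr')
  have [measurable]: "rl_trunc a d \<in> borel_measurable borel"
    using cont by (rule borel_measurable_continuous_onI)
  have bound: "\<bar>rl_trunc a d u\<bar> \<le> d powr (a - 1)" for u
  proof -
    consider "u \<le> 0" | "0 < u" "u \<le> d" | "d < u" by linarith
    then show ?thesis
    proof cases
      case 2
      then have "u powr a \<le> d powr a" using a by (intro powr_mono2) auto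
      then show ?thesis using 2 d by (simp add: rl_trunc_def powr_diff divide_right_mono)
    next
      case 3
      then have "u powr (a - 1) \<le> d powr (a - 1)" using a d by (intro powr_mono2') auto
      then show ?thesis using 3 d by (simp add: rl_trunc_def powr_diff)
    qed (simp add: rl_trunc_def)
  qed
  show ?thesis
    unfolding continuous_on_sequentially
  proof safe
    fix x :: "nat \<Rightarrow> real" and t assume x: "x \<longlonglongrightarrow> t"
    have "(\<lambda>n. LINT s|lborel. rl_trunc a d (x n - s) * g s) \<longlonglongrightarrow> (LINT s|lborel. rl_trunc a d (t - s) * g s)"
    proof (rule integral_dominated_convergence[where w = "\<lambda>s. d powr (a - 1) * \<bar>g s\<bar>"])
      show "integrable lborel (\<lambda>s. d powr (a - 1) * \<bar>g s\<bar>)"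
        using integrable_density by auto
      show "AE s in lborel. (\<lambda>n. rl_trunc a d (x n - s) * g s) \<longlonglongrightarrow> rl_trunc a d (t - s) * g s"
      proof (intro AE_I2 tendsto_mult tendsto_const)
        fix s
        show "(\<lambda>n. rl_trunc a d (x n - s)) \<longlonglongrightarrow> rl_trunc a d (t - s)"
          using cont x by (intro continuous_on_tendsto_compose[OF cont] tendsto_intros) auto
      qed
      show "AE s in lborel. norm (rl_trunc a d (x n - s) * g s) \<le> d powr (a - 1) * \<bar>g s\<bar>" for n
        using bound by (auto simp: abs_mult intro!: mult_right_mono)
    qed measurable
    then show "((\<lambda>t. LINT s|lborel. rl_trunc a d (t - s) * g s) \<circ> x) \<longlonglongrightarrow> (LINT s|lborel. rl_trunc a d (t - s) * g s)"
      by (simp add: o_def)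
  qed
qed

text \<open>The two kernels differ only at arguments up to \<open>d\<close>, and there by at most
  \<open>rl_kernel a\<close>; the hypothesis \<open>small\<close> bounds exactly this singular
  part.\<close>

lemma rl_trunc_conv_close:
  assumes d: "0 < d" and e: "0 \<le> e"
    and small: "(\<integral>\<^sup>+s. ennreal (rl_kernel a (t - s) * \<bar>g s\<bar> * indicator {..d} (t - s)) \<partial>lborel) \<le> ennreal e"
  shows "\<bar>rl_conv a g t - (LINT s|lborel. rl_trunc a d (t - s) * g s)\<bar> \<le> e"
proof -
  have [measurable]: "rl_trunc a d \<in> borel_measurable borel"
    unfolding rl_trunc_def by measurable
  have trunc: "0 \<le> rl_trunc a d u" "rl_trunc a d u \<le> rl_kernel a u"
    "d < u \<Longrightarrow> rl_trunc a d u = rl_kernel a u" for u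
  proof -
    have pow: "u powr a = u * rl_kernel a u" if "0 < u"
      using that by (simp add: rl_kernel_pos powr_mult_base)
    show "0 \<le> rl_trunc a d u" using d by (simp add: rl_trunc_def)
    show "d < u \<Longrightarrow> rl_trunc a d u = rl_kernel a u" using d pow by (simp add: rl_trunc_def)
    show "rl_trunc a d u \<le> rl_kernel a u"
    proof (cases "0 < u")
      case True
      have "u / max u d * rl_kernel a u \<le> 1 * rl_kernel a u"
        using True d by (intro mult_right_mono) auto
      then show ?thesis using True pow by (simp add: rl_trunc_def)
    qed (simp add: rl_trunc_def)
  qed
  have int: "integrable lborel (\<lambda>s. rl_trunc a d (t - s) * g s)"
    by (rule Bochner_Integration.integrable_bound[OF integrable_rl_kernel_mult[of t]])
      (use trunc in \<open>auto simp: abs_mult intro!: mult_right_mono\<close>)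
  have "ennreal \<bar>rl_conv a g t - (LINT s|lborel. rl_trunc a d (t - s) * g s)\<bar> =
      ennreal (norm (LINT s|lborel. rl_kernel a (t - s) * g s - rl_trunc a d (t - s) * g s))"
    using int integrable_rl_kernel_mult by (simp add: rl_conv_def)
  also have "\<dots> \<le> (\<integral>\<^sup>+s. ennreal (norm (rl_kernel a (t - s) * g s - rl_trunc a d (t - s) * g s)) \<partial>lborel)"
    using int integrable_rl_kernel_mult by (intro integral_norm_bound_ennreal) auto
  also have "\<dots> \<le> (\<integral>\<^sup>+s. ennreal (rl_kernel a (t - s) * \<bar>g s\<bar> * indicator {..d} (t - s)) \<partial>lborel)"
  proof (intro nn_integral_mono ennreal_leI)
    fix s
    have "\<bar>rl_kernel a (t - s) - rl_trunc a d (t - s)\<bar> \<le> rl_kernel a (t - s) * indicator {..d} (t - s)"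
      using trunc[of "t - s"] by (auto simp: indicator_def)
    then have "\<bar>rl_kernel a (t - s) - rl_trunc a d (t - s)\<bar> * \<bar>g s\<bar> \<le>
        rl_kernel a (t - s) * indicator {..d} (t - s) * \<bar>g s\<bar>"
      by (rule mult_right_mono) simp
    then show "norm (rl_kernel a (t - s) * g s - rl_trunc a d (t - s) * g s) \<le>
        rl_kernel a (t - s) * \<bar>g s\<bar> * indicator {..d} (t - s)"
      by (simp add: mult_ac abs_mult flip: right_diff_distrib)
  qed
  also note small
  finally show ?thesis using e by simp
qed

text \<open>For a < 1 the singularity moves with \<open>t\<close>, so in general no integrable
  function dominates the integrands for all \<open>t\<close> near a point. The convolution is
  instead a uniform limit of continuous ones with truncated kernels.\<close>

lemma continuous_rl_conv: "continuous_on UNIV (rl_conv a g)"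
proof -
  have "\<exists>d>0. \<forall>t. (\<integral>\<^sup>+s. ennreal (rl_kernel a (t - s) * \<bar>g s\<bar> * indicator {..d} (t - s)) \<partial>lborel)
      \<le> ennreal (1 / real (Suc n))" for n
    by (rule nn_integral_rl_kernel_small[of "1 / real (Suc n)"]) auto
  then have "\<exists>d. \<forall>n. 0 < d n \<and> (\<forall>t. (\<integral>\<^sup>+s. ennreal (rl_kernel a (t - s) * \<bar>g s\<bar> * indicator {..d n} (t - s)) \<partial>lborel)
      \<le> ennreal (1 / real (Suc n)))"
    by (intro choice) auto
  then obtain d where d: "\<And>n. 0 < d n"
    and small: "\<And>n t. (\<integral>\<^sup>+s. ennreal (rl_kernel a (t - s) * \<bar>g s\<bar> * indicator {..d n} (t - s)) \<partial>lborel)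
      \<le> ennreal (1 / real (Suc n))"
    by auto
  have "uniform_limit UNIV (\<lambda>n t. LINT s|lborel. rl_trunc a (d n) (t - s) * g s) (rl_conv a g) sequentially"
  proof (rule uniform_limitI)
    fix e :: real assume "0 < e"
    then have "\<forall>\<^sub>F n in sequentially. 1 / real (Suc n) < e"
      using LIMSEQ_inverse_real_of_nat by (auto simp: inverse_eq_divide dest: order_tendstoD)
    then show "\<forall>\<^sub>F n in sequentially. \<forall>t\<in>UNIV.
        dist (LINT s|lborel. rl_trunc a (d n) (t - s) * g s) (rl_conv a g t) < e"
    proof eventually_elim
      case (elim n)
      have "\<bar>rl_conv a g t - (LINT s|lborel. rl_trunc a (d n) (t - s) * g s)\<bar> \<le> 1 / real (Suc n)" for t
        by (rule rl_trunc_conv_close[OF d _ small]) simp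
      from le_less_trans[OF this elim] show ?case
        by (simp add: dist_real_def abs_minus_commute)
    qed
  qed
  then show ?thesis
    by (rule uniform_limit_theorem[rotated]) (simp_all add: continuous_rl_trunc_conv d)
qed

end

subsection \<open>Borel representatives and weak derivatives\<close>

lemma AE_lebesgue_on_iff:
  fixes S :: "real set"
  assumes "S \<in> sets borel"
  shows "(AE x in lebesgue_on S. P x) \<longleftrightarrow> (AE x in lborel. x \<in> S \<longrightarrow> P x)"
  using assms by (subst AE_restrict_space_iff) (auto simp: AE_completion_iff)

text \<open>The differential equations hold almost everywhere on [0,T], whereas weak derivatives and
  L^p live on (0,T); the endpoints form a null set.\<close>

lemma AE_lebesgue_on_Icc_iff:
  fixes T :: real
  shows "(AE t in lebesgue_on {0..T}. P t) \<longleftrightarrow> (AE t in lebesgue_on {0<..<T}. P t)"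
proof -
  have "AE t in lborel. t \<noteq> 0" "AE t in lborel. t \<noteq> T"
    by (rule AE_lborel_singleton)+
  then have "AE t in lborel. (t \<in> {0..T} \<longrightarrow> P t) \<longleftrightarrow> (t \<in> {0<..<T} \<longrightarrow> P t)"
    by eventually_elim auto
  then show ?thesis
    by (simp add: AE_lebesgue_on_iff eventually_subst)
qed

text \<open>No measurability of \<open>g\<close> is assumed: \<open>lebesgue\<close> is complete, so
  agreement almost everywhere with a Borel function makes \<open>g\<close> measurable on
  \<open>S\<close>.\<close>

lemma
  fixes g :: "real \<Rightarrow> real"
  assumes S [measurable]: "S \<in> sets borel" and G [measurable]: "G \<in> borel_measurable borel"
    and eq: "AE s in lborel. s \<in> S \<longrightarrow> g s = G s"
  shows integrable_lebesgue_on_AE_borel: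
      "integrable (lebesgue_on S) g \<longleftrightarrow> integrable lborel (\<lambda>s. indicator S s * G s)"
    and integral_lebesgue_on_AE_borel:
      "(LINT s|lebesgue_on S. g s) = (LINT s|lborel. indicator S s * G s)"
proof -
  have AE: "AE s in lebesgue. indicator S s * G s = indicator S s * g s"
    unfolding AE_completion_iff using eq by eventually_elim (auto simp: indicator_def)
  have G': "(\<lambda>s. indicator S s * G s) \<in> borel_measurable lebesgue"
    by (simp add: measurable_completion)
  have g: "(\<lambda>s. indicator S s * g s) \<in> borel_measurable lebesgue"
    by (rule borel_measurable_AE[OF G' AE])
  have "integrable (lebesgue_on S) g \<longleftrightarrow> integrable lebesgue (\<lambda>s. indicator S s * g s)"
    by (subst integrable_restrict_space) (simp_all add: S)
  also have "\<dots> \<longleftrightarrow> integrable lebesgue (\<lambda>s. indicator S s * G s)"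
    using AE g G' by (intro integrable_cong_AE) auto
  also have "\<dots> \<longleftrightarrow> integrable lborel (\<lambda>s. indicator S s * G s)"
    by (rule integrable_completion) simp
  finally show "integrable (lebesgue_on S) g \<longleftrightarrow> integrable lborel (\<lambda>s. indicator S s * G s)" .
  have "(LINT s|lebesgue_on S. g s) = (LINT s|lebesgue. indicator S s * g s)"
    by (subst integral_restrict_space) (simp_all add: S)
  also have "\<dots> = (LINT s|lebesgue. indicator S s * G s)"
    using AE g G' by (intro integral_cong_AE) auto
  also have "\<dots> = (LINT s|lborel. indicator S s * G s)"
    by (rule integral_completion) simp
  finally show "(LINT s|lebesgue_on S. g s) = (LINT s|lborel. indicator S s * G s)" .
qed

text \<open>Borel measurability gives access to Fubini on \<open>lborel\<close>; vanishing outside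
  (0,T) turns integrals over subintervals into integrals over the line.\<close>

definition borel_version :: "real \<Rightarrow> (real \<Rightarrow> real) \<Rightarrow> (real \<Rightarrow> real) \<Rightarrow> bool" where
  "borel_version T g G \<longleftrightarrow> G \<in> borel_measurable borel \<and> (\<forall>s. s \<notin> {0<..<T} \<longrightarrow> G s = 0) \<and>
     (AE s in lborel. s \<in> {0<..<T} \<longrightarrow> g s = G s)"

lemma borel_version_exists:
  assumes "g \<in> borel_measurable (lebesgue_on {0<..<T})"
  obtains G where "borel_version T g G"
proof -
  have "(\<lambda>s. indicator {0<..<T} s * g s) \<in> borel_measurable lebesgue"
    using assms by (subst (asm) borel_measurable_restrict_space_iff) simp_all
  then obtain G where [measurable]: "G \<in> borel_measurable borel"
    and eq: "AE s in lborel. indicator {0<..<T} s * g s = G s"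
    by (auto dest: completion_ex_borel_measurable_real)
  show thesis
  proof (rule that)
    show "borel_version T g (\<lambda>s. indicator {0<..<T} s * G s)"
      unfolding borel_version_def using eq
      by (auto elim!: eventually_mono split: if_splits)
  qed
qed

context
  fixes T :: real and g G :: "real \<Rightarrow> real"
  assumes version: "borel_version T g G"
begin

lemma borel_version_measurable: "G \<in> borel_measurable borel"
  and borel_version_zero: "s \<notin> {0<..<T} \<Longrightarrow> G s = 0"
  and borel_version_AE: "AE s in lborel. s \<in> {0<..<T} \<longrightarrow> g s = G s"
  using version by (auto simp: borel_version_def)

lemma
  assumes K [measurable]: "K \<in> borel_measurable borel"
  shows borel_version_integrable: "integrable (lebesgue_on {0<..<T}) (\<lambda>s. K s * g s) \<longleftrightarrow> integrable lborel (\<lambda>s. K s * G s)"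
    and borel_version_integral: "(LINT s|lebesgue_on {0<..<T}. K s * g s) = (LINT s|lborel. K s * G s)"
proof -
  note [measurable] = borel_version_measurable
  have eq: "AE s in lborel. s \<in> {0<..<T} \<longrightarrow> K s * g s = K s * G s"
    using borel_version_AE by eventually_elim auto
  have "(\<lambda>s. indicator {0<..<T} s * (K s * G s)) = (\<lambda>s. K s * G s)"
    using borel_version_zero by (auto simp: fun_eq_iff indicator_def)
  then show "integrable (lebesgue_on {0<..<T}) (\<lambda>s. K s * g s) \<longleftrightarrow> integrable lborel (\<lambda>s. K s * G s)"
    "(LINT s|lebesgue_on {0<..<T}. K s * g s) = (LINT s|lborel. K s * G s)"
    using integrable_lebesgue_on_AE_borel[OF _ _ eq] integral_lebesgue_on_AE_borel[OF _ _ eq] by auto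
qed

lemma borel_version_integrable_self: "integrable (lebesgue_on {0<..<T}) g \<longleftrightarrow> integrable lborel G"
  using borel_version_integrable[of "\<lambda>_. 1"] by simp

text \<open>The restriction to (0,t) is absorbed on the left by \<open>G\<close>, on the right by
  the kernel. The bound \<open>t \<le> T\<close> matters because \<open>G\<close> vanishes beyond
  \<open>T\<close> while \<open>g\<close> need not.\<close>

lemma
  assumes "t \<le> T"
  shows integrable_rl_kernel_lebesgue_on: "integrable (lebesgue_on {0<..<t}) (\<lambda>s. (t - s) powr (a - 1) * g s)
      \<longleftrightarrow> integrable lborel (\<lambda>s. rl_kernel a (t - s) * G s)"
    and integral_rl_kernel_lebesgue_on: "(LINT s|lebesgue_on {0<..<t}. (t - s) powr (a - 1) * g s) = rl_conv a G t"
proof -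
  note [measurable] = borel_version_measurable
  have eq: "AE s in lborel. s \<in> {0<..<t} \<longrightarrow> (t - s) powr (a - 1) * g s = rl_kernel a (t - s) * G s"
    using borel_version_AE assms by (auto elim!: eventually_mono simp: rl_kernel_pos)
  have "(\<lambda>s. indicator {0<..<t} s * (rl_kernel a (t - s) * G s)) = (\<lambda>s. rl_kernel a (t - s) * G s)"
  proof
    show "indicator {0<..<t} s * (rl_kernel a (t - s) * G s) = rl_kernel a (t - s) * G s" for s
      using borel_version_zero[of s] by (cases "s < t") (auto simp: indicator_def)
  qed
  then show "integrable (lebesgue_on {0<..<t}) (\<lambda>s. (t - s) powr (a - 1) * g s)
      \<longleftrightarrow> integrable lborel (\<lambda>s. rl_kernel a (t - s) * G s)"
    "(LINT s|lebesgue_on {0<..<t}. (t - s) powr (a - 1) * g s) = rl_conv a G t"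
    using integrable_lebesgue_on_AE_borel[OF _ _ eq] integral_lebesgue_on_AE_borel[OF _ _ eq]
    by (auto simp: rl_conv_def)
qed

lemma RL_integral_eq_rl_conv: "t \<le> T \<Longrightarrow> RL_integral a g t = rl_conv a G t / Gamma a"
  by (simp add: RL_integral_def integral_rl_kernel_lebesgue_on)

end

lemma borel_version_continuous:
  fixes h :: "real \<Rightarrow> real"
  assumes "continuous_on {0..T} h"
  shows "borel_version T h (\<lambda>s. indicator {0<..<T} s * h s)"
proof -
  have "continuous_on {0<..<T} h"
    using assms by (rule continuous_on_subset) auto
  then have "(\<lambda>s. indicator {0<..<T} s * h s) \<in> borel_measurable borel"
    using borel_measurable_continuous_on_indicator[of "{0<..<T}" h] by simp
  then show ?thesis
    unfolding borel_version_def by (intro conjI allI impI AE_I2) simp_all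
qed

text \<open>The kernel of order 1 is an indicator, so the convolution is the primitive of
  \<open>h\<close>, whose derivative is \<open>h\<close> by continuity.\<close>

lemma continuous_zero_if_rl_conv_1_zero:
  assumes h: "continuous_on {0..T} h" and t: "t \<in> {0<..<T}"
    and zero: "\<And>t. t \<in> {0<..<T} \<Longrightarrow> rl_conv 1 (\<lambda>s. indicator {0<..<T} s * h s) t = 0"
  shows "h t = 0"
proof -
  have int0: "integral {0..r} h = 0" if "r \<in> {0<..<T}" for r
  proof -
    have "continuous_on {0..r} h"
      using that by (intro continuous_on_subset[OF h]) auto
    then have "integral {0..r} h = (LINT s|lebesgue_on {0<..<r}. h s)"
      by (rule integral_lebesgue_on_Ioo[symmetric])
    also have "\<dots> = (LINT s|lebesgue_on {0<..<r}. (r - s) powr (1 - 1) * h s)"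
      by (intro Bochner_Integration.integral_cong) auto
    also have "\<dots> = rl_conv 1 (\<lambda>s. indicator {0<..<T} s * h s) r"
      using integral_rl_kernel_lebesgue_on[OF borel_version_continuous[OF h], of r 1] that by auto
    finally show ?thesis using zero that by simp
  qed
  have "((\<lambda>r. integral {0..r} h) has_vector_derivative h t) (at t within {0..T})"
    using h t by (intro integral_has_vector_derivative) auto
  moreover have "at t within {0..T} = at t"
    using t by (intro at_within_interior) auto
  ultimately have 1: "((\<lambda>r. integral {0..r} h) has_vector_derivative h t) (at t)"
    by simp
  have "((\<lambda>r. integral {0..r} h) has_vector_derivative 0) (at t)"
    by (rule has_vector_derivative_transform_within_open[OF has_vector_derivative_const, where S = "{0<..<T}"])
      (use t int0 in auto)
  with 1 show ?thesis
    by (rule vector_derivative_unique_at)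
qed

lemma Lp_1_iff:
  fixes u :: "real \<Rightarrow> 'a::euclidean_space"
  shows "u \<in> Lp 1 T \<longleftrightarrow> integrable (lebesgue_on {0<..<T}) u"
proof -
  have "u \<in> borel_measurable (lebesgue_on {0<..<T}) \<Longrightarrow>
    integrable (lebesgue_on {0<..<T}) (\<lambda>t. norm (u t)) \<longleftrightarrow> integrable (lebesgue_on {0<..<T}) u"
    by (rule integrable_norm_iff)
  then show ?thesis
    by (auto simp: Lp_def powr_one)
qed

lemma test_function_measurable:
  assumes "test_function T \<psi>"
  shows "\<psi> \<in> borel_measurable borel" "deriv \<psi> \<in> borel_measurable borel"
proof -
  have "smooth \<psi>" using assms by (simp add: test_function_iff)
  then show "\<psi> \<in> borel_measurable borel" "deriv \<psi> \<in> borel_measurable borel"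
    by (intro borel_measurable_continuous_onI smooth_continuous_on smooth_deriv, assumption)+
qed

lemma is_weak_derivative_iff_borel_version:
  fixes u v :: "real \<Rightarrow> real"
  assumes U: "borel_version T u U" and V: "borel_version T v V"
  shows "is_weak_derivative T u v \<longleftrightarrow> integrable lborel U \<and> integrable lborel V \<and>
    (\<forall>\<psi>. test_function T \<psi> \<longrightarrow> (LINT t|lborel. deriv \<psi> t * U t) = - (LINT t|lborel. \<psi> t * V t))"
proof -
  have "(LINT t|lebesgue_on {0<..<T}. deriv \<psi> t * u t) = (LINT t|lborel. deriv \<psi> t * U t)"
    "(LINT t|lebesgue_on {0<..<T}. \<psi> t * v t) = (LINT t|lborel. \<psi> t * V t)"
    if "test_function T \<psi>" for \<psi>
    using borel_version_integral[OF U] borel_version_integral[OF V] test_function_measurable[OF that]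
    by blast+
  then show ?thesis
    unfolding is_weak_derivative_def Lp_1_iff borel_version_integrable_self[OF U]
      borel_version_integrable_self[OF V] real_scaleR_def
    by (intro conj_cong refl all_cong1 imp_cong) simp_all
qed

text \<open>Functions that agree almost everywhere on (0,T) share a Borel representative, so the
  measurability of \<open>u'\<close> and \<open>v'\<close> comes for free.\<close>

lemma is_weak_derivative_cong:
  fixes u v u' v' :: "real \<Rightarrow> real"
  assumes wd: "is_weak_derivative T u v"
    and u: "AE t in lborel. t \<in> {0<..<T} \<longrightarrow> u t = u' t"
    and v: "AE t in lborel. t \<in> {0<..<T} \<longrightarrow> v t = v' t"
  shows "is_weak_derivative T u' v'"
proof -
  have um: "u \<in> borel_measurable (lebesgue_on {0<..<T})" and vm: "v \<in> borel_measurable (lebesgue_on {0<..<T})"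
    using wd by (simp_all add: is_weak_derivative_def Lp_def)
  obtain U where U: "borel_version T u U"
    by (rule borel_version_exists[OF um])
  obtain V where V: "borel_version T v V"
    by (rule borel_version_exists[OF vm])
  have "AE t in lborel. t \<in> {0<..<T} \<longrightarrow> u' t = U t"
    using borel_version_AE[OF U] u by eventually_elim auto
  with U have U': "borel_version T u' U"
    unfolding borel_version_def by blast
  have "AE t in lborel. t \<in> {0<..<T} \<longrightarrow> v' t = V t"
    using borel_version_AE[OF V] v by eventually_elim auto
  with V have V': "borel_version T v' V"
    unfolding borel_version_def by blast
  show ?thesis
    using wd unfolding is_weak_derivative_iff_borel_version[OF U V] is_weak_derivative_iff_borel_version[OF U' V'] .
qed

text \<open>After the exchange of integrals the inner one is the integral of
  \<open>deriv \<psi>\<close> from \<open>s\<close> to \<open>T\<close>, which is -\<psi> s. The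
  density is only asked to be integrable because the lemma is also applied to one with a term
  s^(-a).\<close>

lemma is_weak_derivative_rl_conv_1:
  assumes T: "0 < T" and g: "integrable lborel g" and g0: "\<And>s. s \<notin> {0<..<T} \<Longrightarrow> g s = 0"
  shows "is_weak_derivative T (rl_conv 1 g) g"
proof -
  have [measurable]: "g \<in> borel_measurable borel" using g by simp
  define G where "G t = indicator {0<..<T} t * rl_conv 1 g t" for t
  have version: "borel_version T (rl_conv 1 g) G"
    unfolding borel_version_def G_def[abs_def] by (intro conjI allI impI AE_I2) simp_all
  have version': "borel_version T g g"
    unfolding borel_version_def using g0 by (intro conjI allI impI AE_I2) simp_all
  have "(LINT t|lborel. deriv \<psi> t * G t) = - (LINT t|lborel. \<psi> t * g t)" if \<psi>: "test_function T \<psi>" for \<psi>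
  proof -
    have smooth: "smooth \<psi>" using \<psi> by (simp add: test_function_iff)
    have cont: "continuous_on UNIV (deriv \<psi>)"
      by (intro smooth_continuous_on smooth_deriv smooth)
    have [measurable]: "deriv \<psi> \<in> borel_measurable borel"
      using cont by (rule borel_measurable_continuous_onI)
    have "compact (deriv \<psi> ` {0..T})"
      using cont by (intro compact_continuous_image) (auto intro: continuous_on_subset)
    then obtain M where M: "\<And>t. t \<in> {0..T} \<Longrightarrow> \<bar>deriv \<psi> t\<bar> \<le> M"
      using compact_imp_bounded by (fastforce simp: bounded_iff)
    have M0: "0 \<le> M" using M[of 0] T by auto
    define F where "F = (\<lambda>(s, t). indicator {0<..<T} t * rl_kernel 1 (t - s) * g s)"
    have intF: "integrable (lborel \<Otimes>\<^sub>M lborel) F"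
      unfolding F_def using T g g0 by (intro integrable_pair_rl_kernel) auto
    have int: "integrable (lborel \<Otimes>\<^sub>M lborel) (\<lambda>(s, t). deriv \<psi> t * F (s, t))"
    proof (rule Bochner_Integration.integrable_bound)
      show "integrable (lborel \<Otimes>\<^sub>M lborel) (\<lambda>x. M * F x)"
        using intF by simp
      show "(\<lambda>(s, t). deriv \<psi> t * F (s, t)) \<in> borel_measurable (lborel \<Otimes>\<^sub>M lborel)"
        unfolding F_def by measurable
      have "\<bar>deriv \<psi> t * F (s, t)\<bar> \<le> \<bar>M * F (s, t)\<bar>" for s t
      proof (cases "t \<in> {0<..<T}")
        case True
        then show ?thesis
          using M[of t] M0 by (auto simp: abs_mult intro!: mult_right_mono)
      qed (simp add: F_def)
      then show "AE x in lborel \<Otimes>\<^sub>M lborel. norm (case x of (s, t) \<Rightarrow> deriv \<psi> t * F (s, t)) \<le> norm (M * F x)"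
        by auto
    qed
    have inner: "(LINT t|lborel. deriv \<psi> t * F (s, t)) = - (\<psi> s * g s)" for s
    proof (cases "s \<in> {0<..<T}")
      case True
      \<comment> \<open>Passing from s < t < T to the closed interval changes only these two points
        and makes the fundamental theorem applicable.\<close>
      have "AE t in lborel. t \<noteq> s" "AE t in lborel. t \<noteq> T"
        by (rule AE_lborel_singleton)+
      then have "AE t in lborel. deriv \<psi> t * F (s, t) = deriv \<psi> t * indicator {s..T} t * g s"
        by eventually_elim (use True in \<open>auto simp: F_def indicator_def rl_kernel_def\<close>)
      then have "(LINT t|lborel. deriv \<psi> t * F (s, t)) = (LINT t|lborel. deriv \<psi> t * indicator {s..T} t * g s)"
        unfolding F_def by (intro integral_cong_AE) auto
      also have "(LINT t|lborel. deriv \<psi> t * indicator {s..T} t) = \<psi> T - \<psi> s"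
        using True cont by (intro integral_FTC_Icc_real smooth_has_derivative smooth)
          (auto simp: continuous_on_eq_continuous_at)
      then have "(LINT t|lborel. deriv \<psi> t * indicator {s..T} t * g s) = (\<psi> T - \<psi> s) * g s"
        by simp
      finally show ?thesis
        using test_function_zero[OF \<psi>, of T] by simp
    qed (simp add: F_def g0)
    have "(LINT t|lborel. deriv \<psi> t * G t) = (LINT t|lborel. LINT s|lborel. deriv \<psi> t * F (s, t))"
      by (simp add: F_def G_def rl_conv_def mult.assoc)
    also have "\<dots> = (LINT s|lborel. LINT t|lborel. deriv \<psi> t * F (s, t))"
      using int by (rule lborel_pair.Fubini_integral)
    also have "\<dots> = - (LINT t|lborel. \<psi> t * g t)"
      by (simp add: inner)
    finally show ?thesis .
  qed
  moreover have "integrable lborel G"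
    unfolding G_def using T g g0 by (intro integrable_rl_conv) auto
  ultimately show ?thesis
    using g unfolding is_weak_derivative_iff_borel_version[OF version version'] by blast
qed

subsection \<open>A Volterra inequality\<close>

text \<open>
  Splitting the kernel at distance \<open>d\<close> from the diagonal leaves an operator \<open>V\<close> whose norm on
  \<open>L\<^sup>1\<close> is at most 1/2.  The excess \<open>w\<close> of \<open>h\<close> over twice the remaining constant satisfies
  \<open>w \<le> V w\<close> almost everywhere, hence vanishes.
\<close>

lemma volterra_inequality_bounded:
  fixes k h :: "real \<Rightarrow> real"
  assumes k [measurable]: "k \<in> borel_measurable borel" and k_nonneg: "\<And>u. 0 \<le> k u"
    and k_small: "(\<integral>\<^sup>+u. ennreal (k u * indicator {..d} u) \<partial>lborel) \<le> ennreal (1 / 2)"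
    and k_bound: "\<And>u. d < u \<Longrightarrow> k u \<le> M" and M: "0 \<le> M"
    and h: "integrable lborel h" and h_nonneg: "\<And>t. 0 \<le> h t" and A: "0 \<le> A"
    and le: "\<And>t. ennreal (h t) \<le> ennreal A + (\<integral>\<^sup>+s. ennreal (k (t - s) * h s) \<partial>lborel)"
  shows "AE t in lborel. h t \<le> 2 * (A + M * (LINT s|lborel. h s))"
proof -
  have [measurable]: "h \<in> borel_measurable borel" using h by simp
  define B where "B = A + M * (LINT s|lborel. h s)"
  have B: "0 \<le> B" using A M h_nonneg by (simp add: B_def)
  define kd where "kd u = k u * indicator {..d} u" for u
  have [measurable]: "kd \<in> borel_measurable borel" unfolding kd_def by measurable
  have kd_nonneg: "0 \<le> kd u" for u using k_nonneg by (simp add: kd_def)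
  have kd_int: "(\<integral>\<^sup>+s. ennreal (kd (t - s)) \<partial>lborel) \<le> ennreal (1 / 2)" for t
    using nn_integral_real_affine[of "\<lambda>u. ennreal (kd u)" "-1" t] k_small by (simp add: kd_def)
  \<comment> \<open>Beyond distance \<open>d\<close> the kernel is at most \<open>M\<close>; its
    contribution, at most M times the integral of \<open>h\<close>, is absorbed into
    \<open>B\<close>.\<close>
  have le_kd: "ennreal (h t) \<le> ennreal B + (\<integral>\<^sup>+s. ennreal (kd (t - s) * h s) \<partial>lborel)" for t
  proof -
    have "(\<integral>\<^sup>+s. ennreal (k (t - s) * h s) \<partial>lborel) \<le>
        (\<integral>\<^sup>+s. ennreal M * ennreal (h s) + ennreal (kd (t - s) * h s) \<partial>lborel)"
    proof (rule nn_integral_mono)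
      fix s
      have "k (t - s) \<le> M + kd (t - s)"
        using k_bound[of "t - s"] M by (auto simp: kd_def indicator_def)
      then have "k (t - s) * h s \<le> (M + kd (t - s)) * h s"
        using h_nonneg by (rule mult_right_mono)
      then show "ennreal (k (t - s) * h s) \<le> ennreal M * ennreal (h s) + ennreal (kd (t - s) * h s)"
        using M h_nonneg[of s] kd_nonneg[of "t - s"]
        by (simp add: distrib_right flip: ennreal_mult ennreal_plus)
    qed
    also have "\<dots> = ennreal M * (\<integral>\<^sup>+s. ennreal (h s) \<partial>lborel) + (\<integral>\<^sup>+s. ennreal (kd (t - s) * h s) \<partial>lborel)"
      by (simp add: nn_integral_add nn_integral_cmult)
    also have "ennreal M * (\<integral>\<^sup>+s. ennreal (h s) \<partial>lborel) = ennreal (M * (LINT s|lborel. h s))"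
      using M h h_nonneg by (simp add: nn_integral_eq_integral ennreal_mult)
    finally have "ennreal (h t) \<le> ennreal A + (ennreal (M * (LINT s|lborel. h s)) +
        (\<integral>\<^sup>+s. ennreal (kd (t - s) * h s) \<partial>lborel))"
      using le[of t] by (meson add_left_mono order_trans)
    also have "\<dots> = ennreal B + (\<integral>\<^sup>+s. ennreal (kd (t - s) * h s) \<partial>lborel)"
      using A M h_nonneg by (simp add: B_def ennreal_plus add.assoc)
    finally show ?thesis .
  qed
  \<comment> \<open>The threshold 2B is the fixed point of x = B + x/2: the truncated kernel has
    mass at most 1/2, so the constant 2B feeds back at most B.\<close>
  define w where "w t = max 0 (h t - 2 * B)" for t
  have [measurable]: "w \<in> borel_measurable borel" unfolding w_def by measurable
  have w_nonneg: "0 \<le> w t" for t by (simp add: w_def)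
  define V where "V t = (\<integral>\<^sup>+s. ennreal (kd (t - s)) * ennreal (w s) \<partial>lborel)" for t
  have w_le: "ennreal (w t) \<le> V t" for t
  proof -
    have "(\<integral>\<^sup>+s. ennreal (kd (t - s) * h s) \<partial>lborel) \<le>
        (\<integral>\<^sup>+s. ennreal (kd (t - s)) * ennreal (2 * B) + ennreal (kd (t - s)) * ennreal (w s) \<partial>lborel)"
    proof (rule nn_integral_mono)
      fix s
      have "kd (t - s) * h s \<le> kd (t - s) * (2 * B + w s)"
        using kd_nonneg by (intro mult_left_mono) (auto simp: w_def)
      then show "ennreal (kd (t - s) * h s) \<le>
          ennreal (kd (t - s)) * ennreal (2 * B) + ennreal (kd (t - s)) * ennreal (w s)"
        using kd_nonneg[of "t - s"] B w_nonneg[of s]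
        by (simp add: distrib_left flip: ennreal_mult ennreal_plus)
    qed
    also have "\<dots> = (\<integral>\<^sup>+s. ennreal (kd (t - s)) \<partial>lborel) * ennreal (2 * B) + V t"
      by (simp add: nn_integral_add nn_integral_multc V_def)
    also have "\<dots> \<le> ennreal (1 / 2) * ennreal (2 * B) + V t"
      using kd_int by (intro add_right_mono mult_right_mono) auto
    also have "ennreal (1 / 2) * ennreal (2 * B) = ennreal B"
      using B by (simp flip: ennreal_mult del: ennreal_half)
    finally have "ennreal (h t) \<le> ennreal B + (ennreal B + V t)"
      using le_kd[of t] by (meson add_left_mono order_trans)
    then have *: "ennreal (h t) \<le> ennreal (2 * B) + V t"
      using B by (simp flip: add.assoc ennreal_plus)
    show ?thesis
    proof (cases "h t \<le> 2 * B")
      case False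
      then have "ennreal (2 * B) + ennreal (w t) \<le> ennreal (2 * B) + V t"
        using * B by (simp add: w_def flip: ennreal_plus)
      then show ?thesis
        by (simp add: ennreal_add_left_cancel_le)
    qed (simp add: w_def)
  qed
  have w_int: "(\<integral>\<^sup>+s. ennreal (w s) \<partial>lborel) \<le> ennreal (LINT s|lborel. h s)"
  proof -
    have "(\<integral>\<^sup>+s. ennreal (w s) \<partial>lborel) \<le> (\<integral>\<^sup>+s. ennreal (h s) \<partial>lborel)"
      using B h_nonneg by (intro nn_integral_mono ennreal_leI) (auto simp: w_def)
    then show ?thesis
      using h h_nonneg by (simp add: nn_integral_eq_integral)
  qed
  define W where "W = (\<integral>\<^sup>+s. ennreal (w s) \<partial>lborel)"
  have "W \<le> (\<integral>\<^sup>+t. V t \<partial>lborel)"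
    unfolding W_def by (intro nn_integral_mono w_le)
  also have "\<dots> = (\<integral>\<^sup>+s. \<integral>\<^sup>+t. ennreal (kd (t - s)) * ennreal (w s) \<partial>lborel \<partial>lborel)"
    unfolding V_def by (rule lborel_pair.Fubini') measurable
  also have "\<dots> = (\<integral>\<^sup>+s. (\<integral>\<^sup>+t. ennreal (kd (t - s)) \<partial>lborel) * ennreal (w s) \<partial>lborel)"
    by (simp add: nn_integral_multc)
  also have "\<dots> \<le> (\<integral>\<^sup>+s. ennreal (1 / 2) * ennreal (w s) \<partial>lborel)"
  proof (intro nn_integral_mono mult_right_mono)
    show "(\<integral>\<^sup>+t. ennreal (kd (t - s)) \<partial>lborel) \<le> ennreal (1 / 2)" for s
      using nn_integral_real_affine[of "\<lambda>u. ennreal (kd u)" 1 "- s"] k_small by (simp add: kd_def)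
  qed simp
  also have "\<dots> = ennreal (1 / 2) * W"
    by (simp add: nn_integral_cmult W_def)
  finally have "W \<le> ennreal (1 / 2) * W" .
  \<comment> \<open>Finiteness of \<open>W\<close> is essential, since infinity also satisfies W <=
    W/2.\<close>
  moreover obtain r where r: "W = ennreal r" "0 \<le> r"
    using w_int unfolding W_def[symmetric] by (cases W) (auto simp: top_unique)
  ultimately have "r \<le> 1 / 2 * r"
    by (simp flip: ennreal_mult del: ennreal_half)
  then have "W = 0" using r by simp
  then have "AE s in lborel. ennreal (w s) = 0"
    unfolding W_def by (subst (asm) nn_integral_0_iff_AE) auto
  then show ?thesis
    unfolding B_def[symmetric]
    by eventually_elim (auto simp: w_def ennreal_eq_0_iff max_def split: if_splits)
qed

section \<open>L^p bounds, uniqueness of weak derivatives, continuous densities\<close>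

lemma borel_version_compose:
  assumes "borel_version T g G" "F \<in> borel_measurable borel" "F 0 = 0"
  shows "borel_version T (\<lambda>s. F (g s)) (\<lambda>s. F (G s))"
proof -
  have "(\<lambda>s. F (G s)) \<in> borel_measurable borel"
    using borel_version_measurable[OF assms(1)] assms(2) by measurable
  moreover have "AE s in lborel. s \<in> {0<..<T} \<longrightarrow> F (g s) = F (G s)"
    using borel_version_AE[OF assms(1)] by eventually_elim auto
  ultimately show ?thesis
    using borel_version_zero[OF assms(1)] assms(3) unfolding borel_version_def by auto
qed

lemma borel_version_integrable_powr:
  assumes "borel_version T g G"
  shows "integrable (lebesgue_on {0<..<T}) (\<lambda>s. \<bar>g s\<bar> powr p) \<longleftrightarrow> integrable lborel (\<lambda>s. \<bar>G s\<bar> powr p)"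
  using borel_version_compose[OF assms, of "\<lambda>x. \<bar>x\<bar> powr p"] by (simp add: borel_version_integrable_self)

lemma integrable_powr_le:
  fixes V G :: "real \<Rightarrow> real"
  assumes [measurable]: "V \<in> borel_measurable borel" "G \<in> borel_measurable borel"
    and G: "integrable lborel (\<lambda>s. \<bar>G s\<bar> powr p)" and p: "0 < p" and c: "0 \<le> c"
    and V0: "\<And>s. s \<notin> {0<..<T} \<Longrightarrow> V s = 0"
    and le: "AE s in lborel. \<bar>V s\<bar> \<le> c + \<bar>G s\<bar>"
  shows "integrable lborel (\<lambda>s. \<bar>V s\<bar> powr p)"
proof (rule Bochner_Integration.integrable_bound)
  have "emeasure lborel {0<..<T} < \<infinity>"
    by (cases "0 \<le> T") auto
  then show "integrable lborel (\<lambda>s. (2 * c) powr p * indicator {0<..<T} s + 2 powr p * \<bar>G s\<bar> powr p)"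
    using G by (intro Bochner_Integration.integrable_add integrable_mult_right integrable_real_indicator) auto
  show "AE s in lborel. norm (\<bar>V s\<bar> powr p) \<le>
      norm ((2 * c) powr p * indicator {0<..<T} s + 2 powr p * \<bar>G s\<bar> powr p)"
    using le
  proof eventually_elim
    case (elim s)
    show ?case
    proof (cases "s \<in> {0<..<T}")
      case True
      have "\<bar>V s\<bar> \<le> 2 * max c \<bar>G s\<bar>" using elim by linarith
      then have "\<bar>V s\<bar> powr p \<le> (2 * max c \<bar>G s\<bar>) powr p"
        using p by (intro powr_mono2) auto
      also have "\<dots> = max ((2 * c) powr p) ((2 * \<bar>G s\<bar>) powr p)"
        using p c by (auto simp: max_def intro!: powr_mono2 antisym)
      also have "\<dots> \<le> (2 * c) powr p + (2 * \<bar>G s\<bar>) powr p"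
        by simp
      finally show ?thesis using True by (simp add: powr_mult)
    qed (use V0 p in simp)
  qed
qed measurable

lemma continuous_on_Icc_constant:
  fixes h :: "real \<Rightarrow> real"
  assumes h: "continuous_on {0..T} h" and T: "0 < T"
    and const: "\<And>t. t \<in> {0<..<T} \<Longrightarrow> h t = c" and t: "t \<in> {0..T}"
  shows "h t = c"
proof -
  have "continuous_on (closure {0<..<T}) h" "t \<in> closure {0<..<T}"
    using assms by auto
  then show ?thesis
    using continuous_constant_on_closure[of "{0<..<T}" h c t] const by blast
qed

text \<open>The difference of the two functions is orthogonal to every \<open>deriv \<psi>\<close>,
  hence constant on (0,T) by du Bois-Reymond and on [0,T] by continuity. A weak derivative fixes a
  function only up to a constant, hence the increments.\<close>

lemma weak_derivative_unique:
  fixes u1 u2 v :: "real \<Rightarrow> real"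
  assumes T: "0 < T" and cont: "continuous_on {0..T} u1" "continuous_on {0..T} u2"
    and wd: "is_weak_derivative T u1 v" "is_weak_derivative T u2 v" and t: "t \<in> {0..T}"
  shows "u1 t - u1 0 = u2 t - u2 0"
proof -
  define u where "u t = u1 t - u2 t" for t
  have contu: "continuous_on {0..T} u"
    unfolding u_def by (intro continuous_intros cont)
  have orth: "(LINT t|lebesgue_on {0<..<T}. deriv \<psi> t * u t) = 0" if \<psi>: "test_function T \<psi>" for \<psi>
  proof -
    have d: "continuous_on {0..T} (deriv \<psi>)"
      using \<psi> by (intro smooth_continuous_on smooth_deriv) (simp add: test_function_iff)
    have "(LINT t|lebesgue_on {0<..<T}. deriv \<psi> t * u t) =
        (LINT t|lebesgue_on {0<..<T}. deriv \<psi> t * u1 t) - (LINT t|lebesgue_on {0<..<T}. deriv \<psi> t * u2 t)"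
      unfolding u_def right_diff_distrib
      by (intro Bochner_Integration.integral_diff integrable_lebesgue_on_Ioo continuous_intros d cont)
    then show ?thesis
      using wd \<psi> by (simp add: is_weak_derivative_def)
  qed
  have mid: "T / 2 \<in> {0<..<T}" using T by simp
  have "u r = u (T / 2)" if "r \<in> {0<..<T}" for r
    using contu that mid orth by (rule du_Bois_Reymond)
  then have "u r = u (T / 2)" if "r \<in> {0..T}" for r
    using continuous_on_Icc_constant[OF contu T _ that] by blast
  from this[OF t] this[of 0] show ?thesis using T by (simp add: u_def)
qed

lemma is_weak_derivative_add_const:
  fixes u v :: "real \<Rightarrow> real"
  assumes T: "0 < T" and cont: "continuous_on {0..T} u" and wd: "is_weak_derivative T u v"
  shows "is_weak_derivative T (\<lambda>t. c + u t) v"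
proof -
  have "(LINT t|lebesgue_on {0<..<T}. deriv \<psi> t * (c + u t)) = (LINT t|lebesgue_on {0<..<T}. deriv \<psi> t * u t)"
    if \<psi>: "test_function T \<psi>" for \<psi>
  proof -
    have d: "continuous_on {0..T} (deriv \<psi>)"
      using \<psi> by (intro smooth_continuous_on smooth_deriv) (simp add: test_function_iff)
    have "(LINT t|lebesgue_on {0<..<T}. deriv \<psi> t * (c + u t)) =
        (LINT t|lebesgue_on {0<..<T}. deriv \<psi> t * c) + (LINT t|lebesgue_on {0<..<T}. deriv \<psi> t * u t)"
      unfolding distrib_left
      by (intro Bochner_Integration.integral_add integrable_lebesgue_on_Ioo continuous_intros d cont)
    then show ?thesis
      using integral_deriv_test_function[OF \<psi>] T by simp
  qed
  moreover have "integrable (lebesgue_on {0<..<T}) (\<lambda>t. c + u t)"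
    by (intro integrable_lebesgue_on_Ioo continuous_intros cont)
  ultimately show ?thesis
    using wd by (simp add: is_weak_derivative_def Lp_1_iff)
qed

text \<open>A continuous function on [0,T] belongs to every L^p, so the exponent can be fitted to
  the order: \<open>1 / a + 1\<close> exceeds both 1 and 1/a. This opens the locale for the order 1
  - a, for which the given exponent may be too small.\<close>

lemma Lp_density_continuous:
  assumes h: "continuous_on {0..T} h" and a: "0 < a" "a \<le> 1"
  shows "Lp_density a (1 / a + 1) T (\<lambda>s. indicator {0<..<T} s * h s)"
proof
  define p where "p = 1 / a + 1"
  have p: "0 < p" using a by (simp add: p_def add_pos_pos)
  have "continuous_on {0..T} (\<lambda>s. \<bar>h s\<bar> powr p)"
    using p h by (intro continuous_on_powr' continuous_intros) auto
  then have "set_integrable lborel {0..T} (\<lambda>s. \<bar>h s\<bar> powr p)"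
    by (rule borel_integrable_atLeastAtMost')
  then have "set_integrable lborel {0<..<T} (\<lambda>s. \<bar>h s\<bar> powr p)"
    by (rule set_integrable_subset) auto
  moreover have "indicator {0<..<T} s *\<^sub>R \<bar>h s\<bar> powr p = \<bar>indicator {0<..<T} s * h s\<bar> powr p" for s
    using p by (simp add: indicator_def)
  ultimately show "integrable lborel (\<lambda>s. \<bar>indicator {0<..<T} s * h s\<bar> powr (1 / a + 1))"
    unfolding p_def[symmetric] by (simp add: set_integrable_def)
  show "(\<lambda>s. indicator {0<..<T} s * h s) \<in> borel_measurable borel"
    by (rule borel_version_measurable[OF borel_version_continuous[OF h]])
qed (use a in \<open>auto simp: field_simps\<close>)

lemma Beta_complement:
  assumes "0 < a" "a < (1 :: real)"
  shows "Beta (1 - a) a = Gamma (1 - a) * Gamma a"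
  by (simp add: Beta_def)

text \<open>Commutativity of convolution. It turns the fractional integral of a constant into a
  primitive, whose weak derivative, the kernel itself, can be read off.\<close>

lemma rl_conv_indicator:
  assumes t: "t \<in> {0<..<T}"
  shows "rl_conv a (indicator {0<..<T}) t = rl_conv 1 (\<lambda>s. indicator {0<..<T} s * rl_kernel a s) t"
proof -
  have "rl_conv a (indicator {0<..<T}) t = (LINT s|lborel. rl_kernel a s * indicator {0<..<T} (t - s))"
    unfolding rl_conv_def
    by (subst lborel_integral_real_affine[where c = "-1" and t = t]) simp_all
  also have "\<dots> = rl_conv 1 (\<lambda>s. indicator {0<..<T} s * rl_kernel a s) t"
    unfolding rl_conv_def
  proof (rule Bochner_Integration.integral_cong)
    show "rl_kernel a s * indicator {0<..<T} (t - s) =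
        rl_kernel 1 (t - s) * (indicator {0<..<T} s * rl_kernel a s)" for s
      using t by (cases "0 < s") (auto simp: indicator_def rl_kernel_def)
  qed simp
  finally show ?thesis .
qed

lemma integrable_rl_kernel_Ioo:
  assumes "0 < a" "0 \<le> T"
  shows "integrable lborel (\<lambda>s. indicator {0<..<T} s * rl_kernel a s)"
proof (rule Bochner_Integration.integrable_bound)
  show "integrable lborel (\<lambda>s. rl_kernel a s * indicator {..T} s)"
    using nn_integral_rl_kernel[OF assms]
    by (intro integrableI_nonneg) auto
qed (auto simp: indicator_def)

subsection \<open>Caputo derivatives and fractional integrals\<close>

lemma rl_conv_scale: "rl_conv a (\<lambda>s. c * g s) t = c * rl_conv a g t"
  by (simp add: rl_conv_def mult.left_commute)

lemma rl_conv_add: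
  assumes "integrable lborel (\<lambda>s. rl_kernel a (t - s) * g s)" "integrable lborel (\<lambda>s. rl_kernel a (t - s) * h s)"
  shows "rl_conv a (\<lambda>s. g s + h s) t = rl_conv a g t + rl_conv a h t"
  using assms by (simp add: rl_conv_def distrib_left)

lemma rl_conv_diff:
  assumes "integrable lborel (\<lambda>s. rl_kernel a (t - s) * g s)" "integrable lborel (\<lambda>s. rl_kernel a (t - s) * h s)"
  shows "rl_conv a (\<lambda>s. g s - h s) t = rl_conv a g t - rl_conv a h t"
  using assms by (simp add: rl_conv_def right_diff_distrib)

lemma integrable_rl_kernel_1:
  assumes "integrable lborel g"
  shows "integrable lborel (\<lambda>s. rl_kernel 1 (t - s) * g s)"
proof (rule Bochner_Integration.integrable_bound[OF assms])
  have [measurable]: "g \<in> borel_measurable borel" using assms by simp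
  show "(\<lambda>s. rl_kernel 1 (t - s) * g s) \<in> borel_measurable lborel" by measurable
qed (auto simp: rl_kernel_def)

lemma Gamma_real_nonzero: "0 < a \<Longrightarrow> Gamma a \<noteq> (0 :: real)"
  by (metis Gamma_real_pos less_irrefl)

context Lp_density
begin

lemma Lp_density_1: "Lp_density 1 p T g"
  by unfold_locales (use p integrable_powr g_zero in auto)

lemma is_weak_derivative_rl_conv: "0 < T \<Longrightarrow> is_weak_derivative T (rl_conv 1 g) g"
  by (rule is_weak_derivative_rl_conv_1) (simp_all add: integrable_density g_zero)

lemma rl_conv_zero: "rl_conv c g 0 = 0"
  by (rule rl_conv_nonpos) (auto simp: g_zero)

lemma rl_conv_complement:
  assumes "a < 1"
  shows "rl_conv (1 - a) (rl_conv a g) t = Gamma (1 - a) * Gamma a * rl_conv 1 g t"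
    and "integrable lborel (\<lambda>s. rl_kernel (1 - a) (t - s) * rl_conv a g s)"
proof -
  interpret one: Lp_density 1 p T g by (rule Lp_density_1)
  have "integrable lborel (\<lambda>r. rl_kernel (1 - a + a) (t - r) * g r)"
    using one.integrable_rl_kernel_mult[of t] by simp
  with assms a show "rl_conv (1 - a) (rl_conv a g) t = Gamma (1 - a) * Gamma a * rl_conv 1 g t"
    "integrable lborel (\<lambda>s. rl_kernel (1 - a) (t - s) * rl_conv a g s)"
    using rl_conv_rl_conv[of "1 - a" a g t] integrable_rl_conv_rl_conv[of "1 - a" a g t]
    by (auto simp: Beta_complement)
qed

lemma caputo_derivative_imp_rl_conv:
  assumes T: "0 < T" and u: "continuous_on {0..T} u"
    and caputo: "is_caputo_derivative T a u v" and v: "borel_version T v g" and t: "t \<in> {0..T}"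
  shows "u t = u 0 + rl_conv a g t / Gamma a"
proof -
  interpret one: Lp_density 1 p T g by (rule Lp_density_1)
  have cont1: "continuous_on {0..T} (rl_conv 1 g)"
    using one.continuous_rl_conv by (rule continuous_on_subset) auto
  have wd1: "is_weak_derivative T (rl_conv 1 g) v"
    using is_weak_derivative_rl_conv[OF T]
    by (rule is_weak_derivative_cong) (use borel_version_AE[OF v] in \<open>auto elim: eventually_mono\<close>)
  show ?thesis
  proof (cases "a = 1")
    case True
    then have "is_weak_derivative T u v"
      using caputo by (auto simp: is_caputo_derivative_def)
    then have "u t - u 0 = rl_conv 1 g t - rl_conv 1 g 0"
      using weak_derivative_unique[OF T u cont1 _ wd1 t] by blast
    then show ?thesis using True by (simp add: rl_conv_zero)
  next
    case False
    then have a1: "a < 1" using a by simp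
    have \<Gamma>: "Gamma a \<noteq> 0" "Gamma (1 - a) \<noteq> 0"
      using a a1 by (simp_all add: Gamma_real_nonzero)
    define r where "r = 1 / Gamma a"
    have r: "r * Gamma a = 1" using \<Gamma> by (simp add: r_def)
    define z where "z s = u s - u 0" for s
    have z: "continuous_on {0..T} z" unfolding z_def by (intro continuous_intros u)
    define Z where "Z s = indicator {0<..<T} s * z s" for s
    have Z: "borel_version T z Z"
      unfolding Z_def by (rule borel_version_continuous[OF z])
    have "Lp_density (1 - a) (1 / (1 - a) + 1) T Z"
      unfolding Z_def using a a1 by (intro Lp_density_continuous[OF z]) auto
    then interpret Z: Lp_density "1 - a" "1 / (1 - a) + 1" T Z .
    have wdZ: "is_weak_derivative T (\<lambda>t. rl_conv (1 - a) Z t / Gamma (1 - a)) v"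
    proof (rule is_weak_derivative_cong)
      show "is_weak_derivative T (RL_integral (1 - a) z) v"
        using caputo False by (simp add: is_caputo_derivative_def z_def[abs_def])
    qed (auto simp: RL_integral_eq_rl_conv[OF Z])
    have contZ: "continuous_on {0..T} (\<lambda>t. rl_conv (1 - a) Z t / Gamma (1 - a))"
      using Z.continuous_rl_conv \<Gamma>
      by (intro continuous_intros) (auto intro: continuous_on_subset)
    \<comment> \<open>Both sides vanish at 0, so equality of increments is equality of
      values.\<close>
    have conv_eq: "rl_conv (1 - a) Z t = Gamma (1 - a) * rl_conv 1 g t" if "t \<in> {0..T}" for t
      using weak_derivative_unique[OF T contZ cont1 wdZ wd1 that] \<Gamma>
      by (simp add: rl_conv_zero Z.rl_conv_zero field_simps)
    define y where "y s = z s - r * rl_conv a g s" for s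
    have y: "continuous_on {0..T} y"
      unfolding y_def using z continuous_rl_conv
      by (intro continuous_intros) (auto intro: continuous_on_subset)
    define Y where "Y s = indicator {0<..<T} s * y s" for s
    have Y: "Lp_density 1 (1 / 1 + 1) T Y"
      unfolding Y_def by (intro Lp_density_continuous[OF y]) auto
    then interpret Y: Lp_density 1 "1 / 1 + 1" T Y .
    \<comment> \<open>Not only for \<open>t\<close> in (0,T): the next convolution, of order
      \<open>a\<close>, sees the whole half-line below \<open>t\<close>.\<close>
    have convY: "rl_conv (1 - a) Y t = 0" if "t \<le> T" for t
    proof (cases "t \<le> 0")
      case False
      have "rl_conv (1 - a) Y t = rl_conv (1 - a) (\<lambda>s. Z s - r * rl_conv a g s) t"
      proof (rule rl_conv_cong)
        fix s assume "s < t"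
        then show "Y s = Z s - r * rl_conv a g s"
          using that rl_conv_nonpos[of g s a] g_zero by (cases "0 < s") (auto simp: Y_def y_def Z_def)
      qed
      also have "\<dots> = rl_conv (1 - a) Z t - r * rl_conv (1 - a) (rl_conv a g) t"
        using rl_conv_complement(2)[OF a1, of t] Z.integrable_rl_kernel_mult[of t]
        by (subst rl_conv_diff) (simp_all add: rl_conv_scale mult.left_commute)
      also have "\<dots> = 0"
        using conv_eq[of t] False that rl_conv_complement(1)[OF a1] r by simp
      finally show ?thesis .
    qed (auto intro!: rl_conv_nonpos simp: Y_def)
    have "rl_conv 1 Y t = 0" if "t \<in> {0<..<T}" for t
    proof -
      have "rl_conv a (rl_conv (1 - a) Y) t = Beta a (1 - a) * rl_conv 1 Y t"
        using rl_conv_rl_conv[of a "1 - a" Y t] Y.integrable_rl_kernel_mult[of t] a a1 by simp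
      moreover have "rl_conv a (rl_conv (1 - a) Y) t = rl_conv a (\<lambda>_. 0) t"
        using that by (intro rl_conv_cong convY) auto
      ultimately show ?thesis
        using \<Gamma> by (simp add: rl_conv_def[of a "\<lambda>_. 0"] Beta_def)
    qed
    then have "y s = 0" if "s \<in> {0<..<T}" for s
      using continuous_zero_if_rl_conv_1_zero[OF y that] unfolding Y_def by blast
    then have "y t = 0"
      using continuous_on_Icc_constant[OF y T _ t] by blast
    then show ?thesis by (simp add: y_def z_def r_def)
  qed
qed

text \<open>For a < 1 two weak derivatives are needed: that of J^(1-a) (u - u 0), which is J^1 g,
  and that of J^(1-a) u, whose constant part has the derivative u 0 s^(-a) / Gamma(1-a). The latter
  is integrable but, as a p > 1, not p-integrable near 0 when u 0 is nonzero; it is therefore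
  handled as an L^1 density outside the locale.\<close>

lemma rl_conv_imp_caputo_derivative:
  assumes T: "0 < T" and v: "borel_version T v g"
    and u_eq: "\<And>t. t \<in> {0..T} \<Longrightarrow> u t = c + rl_conv a g t / Gamma a"
  shows "is_caputo_derivative T a u v" and "continuous_on {0..T} u"
proof -
  have G: "Gamma a \<noteq> 0" using a by (simp add: Gamma_real_nonzero)
  define r where "r = 1 / Gamma a"
  have r: "r * Gamma a = 1" using G by (simp add: r_def)
  have "continuous_on {0..T} (\<lambda>t. c + rl_conv a g t / Gamma a)"
    using continuous_rl_conv G by (intro continuous_intros) (auto intro: continuous_on_subset)
  then show u: "continuous_on {0..T} u"
    by (rule continuous_on_eq) (simp add: u_eq)
  have u0: "u 0 = c" using u_eq[of 0] T by (simp add: rl_conv_zero)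
  interpret one: Lp_density 1 p T g by (rule Lp_density_1)
  have gv: "AE t in lborel. t \<in> {0<..<T} \<longrightarrow> g t = v t"
    using borel_version_AE[OF v] by (auto elim: eventually_mono)
  show "is_caputo_derivative T a u v"
  proof (cases "a = 1")
    case True
    have "is_weak_derivative T (\<lambda>t. c + rl_conv 1 g t) g"
      using is_weak_derivative_rl_conv[OF T]
      by (intro is_weak_derivative_add_const T continuous_on_subset[OF one.continuous_rl_conv]) auto
    then have "is_weak_derivative T u v"
      by (rule is_weak_derivative_cong) (use u_eq True gv in auto)
    then show ?thesis using True by (auto simp: is_caputo_derivative_def W11_def)
  next
    case False
    then have a1: "a < 1" using a by simp
    have G1: "Gamma (1 - a) \<noteq> 0" using a1 by (simp add: Gamma_real_nonzero)
    \<comment> \<open>\<open>q' * k s\<close> will be the weak derivative of J^(1-a) applied to the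
      constant u 0.\<close>
    define q' where "q' = u 0 / Gamma (1 - a)"
    define U where "U s = indicator {0<..<T} s * u s" for s
    have U: "borel_version T u U"
      unfolding U_def by (rule borel_version_continuous[OF u])
    define Z where "Z s = indicator {0<..<T} s * (u s - u 0)" for s
    have Z: "borel_version T (\<lambda>s. u s - u 0) Z"
      unfolding Z_def by (intro borel_version_continuous continuous_intros u)
    have "Lp_density (1 - a) (1 / (1 - a) + 1) T Z"
      unfolding Z_def using a a1 by (intro Lp_density_continuous continuous_intros u) auto
    then interpret Z: Lp_density "1 - a" "1 / (1 - a) + 1" T Z .
    have "Lp_density (1 - a) (1 / (1 - a) + 1) T (\<lambda>s. indicator {0<..<T} s * 1)"
      using a a1 by (intro Lp_density_continuous) auto
    then interpret I: Lp_density "1 - a" "1 / (1 - a) + 1" T "indicator {0<..<T}" by simp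
    define k where "k s = indicator {0<..<T} s * rl_kernel (1 - a) s" for s
    have k: "integrable lborel k"
      unfolding k_def using a1 T by (intro integrable_rl_kernel_Ioo) auto
    have k0: "k s = 0" if "s \<notin> {0<..<T}" for s using that by (simp add: k_def)
    have convZ: "rl_conv (1 - a) Z t = Gamma (1 - a) * rl_conv 1 g t" if "t \<in> {0<..<T}" for t
    proof -
      have "rl_conv (1 - a) Z t = rl_conv (1 - a) (\<lambda>s. r * rl_conv a g s) t"
      proof (rule rl_conv_cong)
        fix s assume "s < t"
        then show "Z s = r * rl_conv a g s"
          using that rl_conv_nonpos[of g s a] g_zero u_eq[of s] by (cases "0 < s") (auto simp: Z_def u0 r_def)
      qed
      also have "\<dots> = Gamma (1 - a) * rl_conv 1 g t"
        using r by (simp add: rl_conv_scale rl_conv_complement[OF a1])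
      finally show ?thesis .
    qed
    have "RL_integral (1 - a) (\<lambda>s. u s - u 0) t = rl_conv 1 g t" if "t \<in> {0<..<T}" for t
      using that G1 convZ by (simp add: RL_integral_eq_rl_conv[OF Z])
    then have wd: "is_weak_derivative T (RL_integral (1 - a) (\<lambda>s. u s - u 0)) v"
      by (intro is_weak_derivative_cong[OF is_weak_derivative_rl_conv[OF T] _ gv]) auto
    have convU: "RL_integral (1 - a) u t = rl_conv 1 (\<lambda>s. g s + q' * k s) t"
      if t: "t \<in> {0<..<T}" for t
    proof -
      have "U = (\<lambda>s. Z s + u 0 * indicator {0<..<T} s)"
        by (auto simp: U_def Z_def fun_eq_iff indicator_def)
      then have "rl_conv (1 - a) U t = rl_conv (1 - a) Z t + u 0 * rl_conv (1 - a) (indicator {0<..<T}) t"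
        using Z.integrable_rl_kernel_mult[of t] I.integrable_rl_kernel_mult[of t]
        by (simp add: rl_conv_add rl_conv_scale mult.left_commute)
      also have "\<dots> = Gamma (1 - a) * rl_conv 1 g t + u 0 * rl_conv 1 k t"
        using convZ[OF t] rl_conv_indicator[OF t] by (simp add: k_def[abs_def])
      finally have "RL_integral (1 - a) u t = rl_conv 1 g t + q' * rl_conv 1 k t"
        using t G1 by (simp add: q'_def RL_integral_eq_rl_conv[OF U] field_simps)
      also have "\<dots> = rl_conv 1 (\<lambda>s. g s + q' * k s) t"
        using integrable_rl_kernel_1[OF integrable_density, of t] integrable_rl_kernel_1[OF k, of t]
        by (subst rl_conv_add) (simp_all add: rl_conv_scale mult.left_commute)
      finally show ?thesis .
    qed
    have "is_weak_derivative T (RL_integral (1 - a) u) (\<lambda>s. g s + q' * k s)"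
    proof (rule is_weak_derivative_cong)
      show "is_weak_derivative T (rl_conv 1 (\<lambda>s. g s + q' * k s))
          (\<lambda>s. g s + q' * k s)"
        using integrable_density k by (intro is_weak_derivative_rl_conv_1 T) (auto simp: g_zero k0)
    qed (auto simp: convU)
    then show ?thesis
      using wd u a a1 by (auto simp: is_caputo_derivative_def W11_def)
  qed
qed

end

text \<open>A common null set is needed because \<open>x\<close> will be replaced by \<phi> t. The
  null sets over a countable dense set of \<open>x\<close> have a null union, and by continuity the
  set of good \<open>x\<close> is closed.\<close>

lemma AE_all_le_if_continuous:
  fixes f :: "'a::euclidean_space \<Rightarrow> real \<Rightarrow> 'b::real_normed_vector"
  assumes cont: "AE t in M. continuous_on UNIV (\<lambda>x. f x t)"
    and le: "\<And>x. AE t in M. norm (f x t) \<le> C * norm x + c t"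
  shows "AE t in M. \<forall>x. norm (f x t) \<le> C * norm x + c t"
proof -
  obtain D :: "'a set" where D: "countable D" "\<And>X. open X \<Longrightarrow> X \<noteq> {} \<Longrightarrow> \<exists>d\<in>D. d \<in> X"
    using countable_dense_setE by blast
  have "closure D = UNIV"
    using D(2)[of "- closure D"] closure_subset[of D] by auto
  have "AE t in M. \<forall>x\<in>D. norm (f x t) \<le> C * norm x + c t"
    using D(1) le by (simp add: AE_ball_countable)
  with cont show ?thesis
  proof eventually_elim
    case (elim t)
    have "closed {x. norm (f x t) \<le> C * norm x + c t}"
      using elim(1) by (intro closed_Collect_le continuous_intros)
    then have "closure D \<subseteq> {x. norm (f x t) \<le> C * norm x + c t}"
      using elim(2) by (intro closure_minimal) auto
    then show ?case using \<open>closure D = UNIV\<close> by auto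
  qed
qed

subsection \<open>The Cauchy problem\<close>

text \<open>The integral is the sum of c_j d^\<alpha>_j / \<alpha>_j, which tends to 0 with
  \<open>d\<close>. Adding the kernels of all components, whatever their orders, reduces the system
  to one scalar inequality.\<close>

lemma rl_kernel_sum_small:
  fixes \<alpha> c :: "'n::finite \<Rightarrow> real"
  assumes \<alpha>: "\<And>j. 0 < \<alpha> j" and c: "\<And>j. 0 \<le> c j"
  obtains d where "0 < d"
    "(\<integral>\<^sup>+u. ennreal ((\<Sum>j\<in>UNIV. c j * rl_kernel (\<alpha> j) u) * indicator {..d} u) \<partial>lborel) \<le> ennreal (1 / 2)"
proof -
  have "((\<lambda>d. \<Sum>j\<in>UNIV. c j * (d powr \<alpha> j / \<alpha> j)) \<longlongrightarrow> 0) (at_right 0)"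
  proof (intro tendsto_null_sum tendsto_mult_right_zero)
    fix j
    have "((\<lambda>d::real. d powr \<alpha> j) \<longlongrightarrow> 0) (at_right 0)"
      by (rule tendsto_zero_powrI[OF _ tendsto_const _ \<alpha>]) (auto simp: eventually_at_right_less less_imp_le eventually_at_filter)
    from tendsto_divide[OF this tendsto_const[of "\<alpha> j"]]
    show "((\<lambda>d. d powr \<alpha> j / \<alpha> j) \<longlongrightarrow> 0) (at_right 0)"
      using \<alpha>[of j] by simp
  qed
  then have "\<forall>\<^sub>F d in at_right 0. (\<Sum>j\<in>UNIV. c j * (d powr \<alpha> j / \<alpha> j)) < 1 / 2"
    by (rule order_tendstoD) simp
  then have "\<forall>\<^sub>F d in at_right (0::real). 0 < d \<and> (\<Sum>j\<in>UNIV. c j * (d powr \<alpha> j / \<alpha> j)) < 1 / 2"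
    using eventually_at_right_less[of "0::real"] by eventually_elim auto
  then obtain d where d: "0 < d" "(\<Sum>j\<in>UNIV. c j * (d powr \<alpha> j / \<alpha> j)) < 1 / 2"
    using eventually_happens'[OF trivial_limit_at_right_real] by blast
  have "(\<integral>\<^sup>+u. ennreal ((\<Sum>j\<in>UNIV. c j * rl_kernel (\<alpha> j) u) * indicator {..d} u) \<partial>lborel) =
      (\<integral>\<^sup>+u. (\<Sum>j\<in>UNIV. ennreal (c j) * ennreal (rl_kernel (\<alpha> j) u * indicator {..d} u)) \<partial>lborel)"
    using c by (intro nn_integral_cong)
      (simp add: sum_distrib_right mult.assoc sum_nonneg flip: ennreal_mult sum_ennreal)
  also have "\<dots> = (\<Sum>j\<in>UNIV. ennreal (c j) * ennreal (d powr \<alpha> j / \<alpha> j))"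
    using d \<alpha> by (simp add: nn_integral_sum nn_integral_cmult nn_integral_rl_kernel)
  also have "\<dots> = ennreal (\<Sum>j\<in>UNIV. c j * (d powr \<alpha> j / \<alpha> j))"
    using c \<alpha> by (simp add: less_imp_le flip: ennreal_mult sum_ennreal)
  also have "\<dots> \<le> ennreal (1 / 2)"
    using d(2) by (intro ennreal_leI) simp
  finally show thesis using d(1) that by blast
qed

lemma rl_kernel_antimono:
  assumes "a \<le> 1" "0 < d" "d \<le> u"
  shows "rl_kernel a u \<le> rl_kernel a d"
  using assms by (auto simp: rl_kernel_pos intro!: powr_mono2')

text \<open>Because \<open>a \<le> 1\<close>, the weight \<open>rl_kernel a (T - s)\<close> is
  bounded below on (0,T) by the positive number \<open>rl_kernel a T\<close>, so a single weighted
  integral already puts \<open>g\<close> in L^1.\<close>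

lemma integrable_of_integrable_rl_kernel:
  assumes a: "a \<le> 1" and [measurable]: "g \<in> borel_measurable borel"
    and g0: "\<And>s. s \<notin> {0<..<T} \<Longrightarrow> g s = 0" and int: "integrable lborel (\<lambda>s. rl_kernel a (T - s) * g s)"
  shows "integrable lborel g"
proof (cases "0 < T")
  case True
  have pos: "0 < rl_kernel a T" using True by (simp add: rl_kernel_pos)
  show ?thesis
  proof (rule Bochner_Integration.integrable_bound)
    show "integrable lborel (\<lambda>s. (1 / rl_kernel a T) * (rl_kernel a (T - s) * g s))"
      using int by (rule integrable_mult_right)
    have "\<bar>g s\<bar> \<le> \<bar>(1 / rl_kernel a T) * (rl_kernel a (T - s) * g s)\<bar>" for s
    proof (cases "s \<in> {0<..<T}")
      case True
      then have "rl_kernel a T * \<bar>g s\<bar> \<le> rl_kernel a (T - s) * \<bar>g s\<bar>"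
        by (intro mult_right_mono rl_kernel_antimono a) auto
      then show ?thesis using pos by (simp add: abs_mult field_simps)
    qed (simp add: g0)
    then show "AE s in lborel. norm (g s) \<le> norm ((1 / rl_kernel a T) * (rl_kernel a (T - s) * g s))"
      unfolding real_norm_def by (rule AE_I2)
  qed measurable
next
  case False
  then have "g = (\<lambda>_. 0)" using g0 by (auto simp: fun_eq_iff)
  then show ?thesis by simp
qed

lemma borel_version_Lp_density:
  fixes w :: "real \<Rightarrow> real"
  assumes w: "w \<in> Lp p T" and a: "0 < a" "a \<le> 1" and p: "1 < p" "1 / a < p" and W: "borel_version T w W"
  shows "Lp_density a p T W"
proof
  show "integrable lborel (\<lambda>s. \<bar>W s\<bar> powr p)"
    using w borel_version_integrable_powr[OF W, of p] by (simp add: Lp_def)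
qed (use a p borel_version_measurable[OF W] borel_version_zero[OF W] in auto)

lemma Lp_component:
  fixes v :: "real \<Rightarrow> real ^ 'n"
  assumes v: "v \<in> Lp p T" and p: "0 < p"
  shows "(\<lambda>t. v t $ j) \<in> Lp p T"
proof -
  have vm: "v \<in> borel_measurable (lebesgue_on {0<..<T})" using v by (simp add: Lp_def)
  have "(\<lambda>x::real^'n. x $ j) \<in> borel_measurable borel"
    by (intro borel_measurable_continuous_onI continuous_intros)
  from measurable_compose[OF vm this]
  have [measurable]: "(\<lambda>t. v t $ j) \<in> borel_measurable (lebesgue_on {0<..<T})" .
  have "integrable (lebesgue_on {0<..<T}) (\<lambda>t. norm (v t $ j) powr p)"
  proof (rule Bochner_Integration.integrable_bound)
    show "integrable (lebesgue_on {0<..<T}) (\<lambda>t. norm (v t) powr p)" using v by (simp add: Lp_def)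
    have "norm (v t $ j) powr p \<le> norm (v t) powr p" for t
      using p component_le_norm_cart[of "v t" j] by (intro powr_mono2) auto
    then show "AE t in lebesgue_on {0<..<T}. norm (norm (v t $ j) powr p) \<le> norm (norm (v t) powr p)"
      by simp
  qed measurable
  then show ?thesis by (simp add: Lp_def)
qed

lemma borel_measurable_vec:
  fixes v :: "'a \<Rightarrow> real ^ 'n"
  assumes "\<And>j. (\<lambda>t. v t $ j) \<in> borel_measurable M"
  shows "v \<in> borel_measurable M"
proof (rule borel_measurable_euclidean_space[THEN iffD2], rule ballI)
  fix i :: "real ^ 'n" assume "i \<in> Basis"
  then obtain j where "i = axis j 1"
    by (auto simp: Basis_vec_def)
  then show "(\<lambda>t. v t \<bullet> i) \<in> borel_measurable M"
    using assms[of j] by (simp add: inner_axis)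
qed

context
  fixes T p :: real and \<alpha> :: "'n::finite \<Rightarrow> real" and f :: "real^'n \<Rightarrow> real \<Rightarrow> real^'n"
    and \<xi> :: "real^'n" and \<phi> :: "real \<Rightarrow> real^'n"
  assumes T: "0 < T" and \<alpha>: "\<And>j. 0 < \<alpha> j" "\<And>j. \<alpha> j \<le> 1" and p: "1 < p" "\<And>j. 1 / \<alpha> j < p"
begin

lemma cauchy_solution_imp_integral_equation:
  assumes sol: "cauchy_solution p T \<alpha> f \<xi> \<phi>" and t: "t \<in> {0..T}"
  shows "integrable (lebesgue_on {0<..<t}) (\<lambda>s. (t - s) powr (\<alpha> j - 1) * f (\<phi> s) s $ j)"
    and "\<phi> t $ j = \<xi> $ j +
      1 / Gamma (\<alpha> j) * (LINT s|lebesgue_on {0<..<t}. (t - s) powr (\<alpha> j - 1) * f (\<phi> s) s $ j)"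
proof -
  obtain v where v: "v \<in> Lp p T"
    and caputo_all: "\<forall>j. is_caputo_derivative T (\<alpha> j) (\<lambda>t. \<phi> t $ j) (\<lambda>t. v t $ j)"
    and vf_all: "\<forall>j. AE t in lebesgue_on {0..T}. v t $ j = f (\<phi> t) t $ j"
    using sol unfolding cauchy_solution_def by (elim conjE bexE)
  note caputo = caputo_all[rule_format, of j] and vf = vf_all[rule_format, of j]
  have \<phi>: "continuous_on {0..T} \<phi>" and init: "\<phi> 0 $ j = \<xi> $ j"
    using sol by (simp_all add: cauchy_solution_def)
  have vj: "(\<lambda>t. v t $ j) \<in> Lp p T"
    using v p(1) by (intro Lp_component) simp_all
  then have "(\<lambda>t. v t $ j) \<in> borel_measurable (lebesgue_on {0<..<T})"
    by (simp add: Lp_def)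
  then obtain V where V: "borel_version T (\<lambda>t. v t $ j) V"
    by (rule borel_version_exists)
  interpret V: Lp_density "\<alpha> j" p T V
    using vj \<alpha> p V by (rule borel_version_Lp_density)
  have "AE t in lborel. t \<in> {0<..<T} \<longrightarrow> v t $ j = f (\<phi> t) t $ j"
    using vf unfolding AE_lebesgue_on_Icc_iff by (simp add: AE_lebesgue_on_iff)
  with borel_version_AE[OF V] have "AE t in lborel. t \<in> {0<..<T} \<longrightarrow> f (\<phi> t) t $ j = V t"
    by eventually_elim auto
  \<comment> \<open>\<open>V\<close> represents the right-hand side as well, which thus inherits its
    measurability from \<open>v\<close>.\<close>
  then have F: "borel_version T (\<lambda>t. f (\<phi> t) t $ j) V"
    using V unfolding borel_version_def by blast
  have tT: "t \<le> T" using t by simp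
  show "integrable (lebesgue_on {0<..<t}) (\<lambda>s. (t - s) powr (\<alpha> j - 1) * f (\<phi> s) s $ j)"
    unfolding integrable_rl_kernel_lebesgue_on[OF F tT] by (rule V.integrable_rl_kernel_mult)
  have "continuous_on {0..T} (\<lambda>t. \<phi> t $ j)"
    using \<phi> by (intro continuous_intros)
  from V.caputo_derivative_imp_rl_conv[OF T this caputo V t]
  show "\<phi> t $ j = \<xi> $ j +
      1 / Gamma (\<alpha> j) * (LINT s|lebesgue_on {0<..<t}. (t - s) powr (\<alpha> j - 1) * f (\<phi> s) s $ j)"
    unfolding integral_rl_kernel_lebesgue_on[OF F tT] by (simp add: init)
qed

text \<open>\<open>h\<close> stands for the l1 norm of \<phi> on (0,T), written through the
  \<open>V j\<close> so that it is Borel on the whole line. All \<open>V j\<close> are controlled by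
  the same \<open>h\<close>, so summing over the components gives a scalar Volterra inequality; the
  L^p function \<open>G\<close> contributes only constants because \<alpha> j p > 1.\<close>

lemma integral_equation_bounded:
  assumes C: "0 \<le> C"
    and V: "\<And>j. integrable lborel (V j)" "\<And>j s. s \<notin> {0<..<T} \<Longrightarrow> V j s = 0"
    and G: "G \<in> borel_measurable borel" "integrable lborel (\<lambda>s. \<bar>G s\<bar> powr p)" "\<And>s. s \<notin> {0<..<T} \<Longrightarrow> G s = 0"
    and h_def: "\<And>t. h t = (\<Sum>j\<in>UNIV. \<bar>indicator {0<..<T} t * (\<xi> $ j + rl_conv (\<alpha> j) (V j) t / Gamma (\<alpha> j))\<bar>)"
    and le: "\<And>j. AE s in lborel. \<bar>V j s\<bar> \<le> C * h s + \<bar>G s\<bar>"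
  obtains B where "0 \<le> B" "AE t in lborel. h t \<le> B"
proof -
  have [measurable]: "V j \<in> borel_measurable borel" for j using V(1)[of j] by simp
  have \<Gamma>: "0 < Gamma (\<alpha> j)" for j using \<alpha> by (simp add: Gamma_real_pos)
  note [measurable] = G(1)
  have h_nonneg: "0 \<le> h t" for t by (simp add: h_def sum_nonneg)
  have "emeasure lborel {0<..<T} < \<infinity>" using T by simp
  then have "integrable lborel (\<lambda>t. \<xi> $ j * indicator {0<..<T} t +
      indicator {0<..<T} t * rl_conv (\<alpha> j) (V j) t / Gamma (\<alpha> j))" for j
    using integrable_rl_conv[OF \<alpha>(1)[of j] _ V(1)[of j] V(2)] T
    by (intro Bochner_Integration.integrable_add integrable_mult_right integrable_real_indicator integrable_divide) auto
  then have "integrable lborel (\<lambda>t. \<bar>indicator {0<..<T} t * (\<xi> $ j + rl_conv (\<alpha> j) (V j) t / Gamma (\<alpha> j))\<bar>)" for j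
    by (intro integrable_abs) (simp add: algebra_simps)
  then have h_int: "integrable lborel h"
    unfolding h_def[abs_def] by (intro Bochner_Integration.integrable_sum)
  then have [measurable]: "h \<in> borel_measurable borel" by simp
  define c where "c j = C / Gamma (\<alpha> j)" for j
  have c: "0 \<le> c j" for j using C \<Gamma>[of j] by (simp add: c_def)
  define k where "k u = (\<Sum>j\<in>UNIV. c j * rl_kernel (\<alpha> j) u)" for u
  obtain d where d: "0 < d" and small: "(\<integral>\<^sup>+u. ennreal (k u * indicator {..d} u) \<partial>lborel) \<le> ennreal (1 / 2)"
    by (rule rl_kernel_sum_small[of \<alpha> c, OF \<alpha>(1) c]) (auto simp: k_def)
  have G_density: "Lp_density (\<alpha> j) p T G" for j
    by unfold_locales (use \<alpha> p G in auto)
  \<comment> \<open>The bound of \<open>nn_integral_rl_kernel_bound\<close> with R = T;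
    \<open>Lp_density.b\<close> is the constant \<open>b\<close> of the locale, seen from
    outside.\<close>
  define b where "b j = T powr Lp_density.b (\<alpha> j) p / Lp_density.b (\<alpha> j) p + (LINT s|lborel. \<bar>G s\<bar> powr p)" for j
  have b: "(\<integral>\<^sup>+s. ennreal (rl_kernel (\<alpha> j) (t - s) * \<bar>G s\<bar>) \<partial>lborel) \<le> ennreal (b j)" if "t \<le> T" for j t
    unfolding b_def using Lp_density.nn_integral_rl_kernel_bound[OF G_density that] T by simp
  have b_nonneg: "0 \<le> b j" for j
    using Lp_density.b_pos[OF G_density[of j]] by (simp add: b_def)
  define A where "A = (\<Sum>j\<in>UNIV. \<bar>\<xi> $ j\<bar> + b j / Gamma (\<alpha> j))"
  have A_summand: "0 \<le> \<bar>\<xi> $ j\<bar> + b j / Gamma (\<alpha> j)" for j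
    using b_nonneg[of j] \<Gamma>[of j] by simp
  have A_nonneg: "0 \<le> A" unfolding A_def by (intro sum_nonneg A_summand)
  have k_nonneg: "0 \<le> k u" for u using c by (simp add: k_def sum_nonneg)
  have "ennreal (h t) \<le> ennreal A + (\<integral>\<^sup>+s. ennreal (k (t - s) * h s) \<partial>lborel)" for t
  proof (cases "t \<in> {0<..<T}")
    case True
    have conv: "ennreal \<bar>rl_conv (\<alpha> j) (V j) t\<bar> \<le>
        ennreal C * (\<integral>\<^sup>+s. ennreal (rl_kernel (\<alpha> j) (t - s) * h s) \<partial>lborel) + ennreal (b j)" for j
    proof -
      have "ennreal \<bar>rl_conv (\<alpha> j) (V j) t\<bar> \<le> (\<integral>\<^sup>+s. ennreal (norm (rl_kernel (\<alpha> j) (t - s) * V j s)) \<partial>lborel)"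
      \<comment> \<open>Integrability of \<open>V j\<close> does not give that of the weighted
        integrand at a given \<open>t\<close>; where it fails, \<open>rl_conv\<close> is 0 by
        default and the bound is trivial.\<close>
      proof (cases "integrable lborel (\<lambda>s. rl_kernel (\<alpha> j) (t - s) * V j s)")
        case True
        then show ?thesis
          unfolding rl_conv_def using integral_norm_bound_ennreal by fastforce
      qed (simp add: rl_conv_def not_integrable_integral_eq)
      also have "\<dots> \<le> (\<integral>\<^sup>+s. ennreal C * ennreal (rl_kernel (\<alpha> j) (t - s) * h s) +
          ennreal (rl_kernel (\<alpha> j) (t - s) * \<bar>G s\<bar>) \<partial>lborel)"
      proof (rule nn_integral_mono_AE)
        show "AE s in lborel. ennreal (norm (rl_kernel (\<alpha> j) (t - s) * V j s)) \<le>
            ennreal C * ennreal (rl_kernel (\<alpha> j) (t - s) * h s) + ennreal (rl_kernel (\<alpha> j) (t - s) * \<bar>G s\<bar>)"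
          using le[of j]
        proof eventually_elim
          case (elim s)
          then have "rl_kernel (\<alpha> j) (t - s) * \<bar>V j s\<bar> \<le> rl_kernel (\<alpha> j) (t - s) * (C * h s + \<bar>G s\<bar>)"
            by (intro mult_left_mono) auto
          then show ?case
            using C h_nonneg[of s]
            by (simp add: abs_mult distrib_left mult.left_commute flip: ennreal_mult ennreal_plus)
        qed
      qed
      also have "\<dots> = ennreal C * (\<integral>\<^sup>+s. ennreal (rl_kernel (\<alpha> j) (t - s) * h s) \<partial>lborel) +
          (\<integral>\<^sup>+s. ennreal (rl_kernel (\<alpha> j) (t - s) * \<bar>G s\<bar>) \<partial>lborel)"
        by (simp add: nn_integral_add nn_integral_cmult)
      also have "\<dots> \<le> ennreal C * (\<integral>\<^sup>+s. ennreal (rl_kernel (\<alpha> j) (t - s) * h s) \<partial>lborel) + ennreal (b j)"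
        using b[of t j] True by (intro add_left_mono) auto
      finally show ?thesis .
    qed
    have summand: "ennreal \<bar>\<xi> $ j + rl_conv (\<alpha> j) (V j) t / Gamma (\<alpha> j)\<bar> \<le>
        ennreal (\<bar>\<xi> $ j\<bar> + b j / Gamma (\<alpha> j)) + (\<integral>\<^sup>+s. ennreal (c j * rl_kernel (\<alpha> j) (t - s) * h s) \<partial>lborel)" for j
    proof -
      have "\<bar>\<xi> $ j + rl_conv (\<alpha> j) (V j) t / Gamma (\<alpha> j)\<bar> \<le>
          \<bar>\<xi> $ j\<bar> + (1 / Gamma (\<alpha> j)) * \<bar>rl_conv (\<alpha> j) (V j) t\<bar>"
        using \<Gamma>[of j] abs_triangle_ineq[of "\<xi> $ j" "rl_conv (\<alpha> j) (V j) t / Gamma (\<alpha> j)"] by simp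
      then have "ennreal \<bar>\<xi> $ j + rl_conv (\<alpha> j) (V j) t / Gamma (\<alpha> j)\<bar> \<le>
          ennreal \<bar>\<xi> $ j\<bar> + ennreal (1 / Gamma (\<alpha> j)) * ennreal \<bar>rl_conv (\<alpha> j) (V j) t\<bar>"
        using \<Gamma>[of j] by (simp add: less_imp_le flip: ennreal_mult ennreal_plus)
      also have "\<dots> \<le> ennreal \<bar>\<xi> $ j\<bar> + ennreal (1 / Gamma (\<alpha> j)) *
          (ennreal C * (\<integral>\<^sup>+s. ennreal (rl_kernel (\<alpha> j) (t - s) * h s) \<partial>lborel) + ennreal (b j))"
        by (intro add_left_mono mult_left_mono conv) simp
      also have "\<dots> = (ennreal \<bar>\<xi> $ j\<bar> + ennreal (1 / Gamma (\<alpha> j)) * ennreal (b j)) +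
          (ennreal (1 / Gamma (\<alpha> j)) * ennreal C) * (\<integral>\<^sup>+s. ennreal (rl_kernel (\<alpha> j) (t - s) * h s) \<partial>lborel)"
        by (simp add: algebra_simps)
      also have "ennreal \<bar>\<xi> $ j\<bar> + ennreal (1 / Gamma (\<alpha> j)) * ennreal (b j) = ennreal (\<bar>\<xi> $ j\<bar> + b j / Gamma (\<alpha> j))"
        using \<Gamma>[of j] b_nonneg[of j] by (simp add: less_imp_le flip: ennreal_mult ennreal_plus)
      also have "ennreal (1 / Gamma (\<alpha> j)) * ennreal C = ennreal (c j)"
        using \<Gamma>[of j] C by (simp add: c_def less_imp_le flip: ennreal_mult)
      also have "ennreal (c j) * (\<integral>\<^sup>+s. ennreal (rl_kernel (\<alpha> j) (t - s) * h s) \<partial>lborel) =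
          (\<integral>\<^sup>+s. ennreal (c j * rl_kernel (\<alpha> j) (t - s) * h s) \<partial>lborel)"
        using c[of j] h_nonneg
        by (subst nn_integral_cmult[symmetric]) (auto simp: mult.assoc simp flip: ennreal_mult)
      finally show ?thesis .
    qed
    have "ennreal (h t) = (\<Sum>j\<in>UNIV. ennreal \<bar>\<xi> $ j + rl_conv (\<alpha> j) (V j) t / Gamma (\<alpha> j)\<bar>)"
      using True by (simp add: h_def sum_ennreal)
    also have "\<dots> \<le> (\<Sum>j\<in>UNIV. ennreal (\<bar>\<xi> $ j\<bar> + b j / Gamma (\<alpha> j)) +
        (\<integral>\<^sup>+s. ennreal (c j * rl_kernel (\<alpha> j) (t - s) * h s) \<partial>lborel))"
      by (intro sum_mono summand)
    also have "\<dots> = ennreal A + (\<Sum>j\<in>UNIV. \<integral>\<^sup>+s. ennreal (c j * rl_kernel (\<alpha> j) (t - s) * h s) \<partial>lborel)"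
      using A_summand by (simp only: sum.distrib A_def sum_ennreal)
    also have "(\<Sum>j\<in>UNIV. \<integral>\<^sup>+s. ennreal (c j * rl_kernel (\<alpha> j) (t - s) * h s) \<partial>lborel) =
        (\<integral>\<^sup>+s. (\<Sum>j\<in>UNIV. ennreal (c j * rl_kernel (\<alpha> j) (t - s) * h s)) \<partial>lborel)"
      by (rule nn_integral_sum[symmetric]) measurable
    also have "\<dots> = (\<integral>\<^sup>+s. ennreal (k (t - s) * h s) \<partial>lborel)"
      using c h_nonneg by (simp add: k_def sum_distrib_right sum_ennreal)
    finally show ?thesis .
  qed (simp add: h_def)
  \<comment> \<open>All orders are at most 1, so the kernels decrease on the positive axis and
    \<open>k d\<close> bounds \<open>k\<close> beyond \<open>d\<close>.\<close>
  then have "AE t in lborel. h t \<le> 2 * (A + k d * (LINT s|lborel. h s))"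
  proof (intro volterra_inequality_bounded[OF _ _ small _ _ h_int h_nonneg])
    show "k \<in> borel_measurable borel" unfolding k_def by measurable
    show "0 \<le> k u" for u by (rule k_nonneg)
    then show "0 \<le> k d" .
    show "k u \<le> k d" if "d < u" for u
      unfolding k_def using that d c \<alpha> by (intro sum_mono mult_left_mono rl_kernel_antimono) auto
    show "0 \<le> A" by (rule A_nonneg)
  qed
  moreover have "0 \<le> 2 * (A + k d * (LINT s|lborel. h s))"
    by (simp add: A_nonneg k_nonneg h_nonneg)
  ultimately show thesis using that by blast
qed

lemma integral_equation_imp_cauchy_solution:
  assumes f: "Lp_caratheodory p T f"
    and eq: "\<forall>j. \<forall>t\<in>{0..T}.
       integrable (lebesgue_on {0<..<t}) (\<lambda>s. (t - s) powr (\<alpha> j - 1) * f (\<phi> s) s $ j) \<and>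
       \<phi> t $ j = \<xi> $ j +
         1 / Gamma (\<alpha> j) * (LINT s|lebesgue_on {0<..<t}. (t - s) powr (\<alpha> j - 1) * f (\<phi> s) s $ j)"
  shows "cauchy_solution p T \<alpha> f \<xi> \<phi>"
proof -
  define v where "v t = f (\<phi> t) t" for t
  have int: "integrable (lebesgue_on {0<..<T}) (\<lambda>s. (T - s) powr (\<alpha> j - 1) * v s $ j)" for j
    using eq T by (auto simp: v_def)
  \<comment> \<open>Measurability cannot come from composing \<open>f\<close> with \<phi>, which is
    not known to be measurable. It is recovered from the integrand at t = T by multiplying with the
    reciprocal weight.\<close>
  have vm: "(\<lambda>s. v s $ j) \<in> borel_measurable (lebesgue_on {0<..<T})" for j
  proof -
    have "(\<lambda>s. (T - s) powr (1 - \<alpha> j)) \<in> borel_measurable (lebesgue_on {0<..<T})"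
      by (intro measurable_restrict_space1 measurable_completion) measurable
    then have "(\<lambda>s. (T - s) powr (1 - \<alpha> j) * ((T - s) powr (\<alpha> j - 1) * v s $ j)) \<in> borel_measurable (lebesgue_on {0<..<T})"
      using borel_measurable_integrable[OF int] by (rule borel_measurable_times)
    moreover have "(T - s) powr (1 - \<alpha> j) * ((T - s) powr (\<alpha> j - 1) * v s $ j) = v s $ j"
      if "s \<in> space (lebesgue_on {0<..<T})" for s
      using that by (simp add: mult.assoc[symmetric] flip: powr_add)
    ultimately show ?thesis
      by (rule measurable_cong[THEN iffD1, rotated])
  qed
  then have "\<forall>j. \<exists>V. borel_version T (\<lambda>s. v s $ j) V"
    by (meson borel_version_exists)
  then obtain V where V: "\<And>j. borel_version T (\<lambda>s. v s $ j) (V j)"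
    by metis
  have V0: "V j s = 0" if "s \<notin> {0<..<T}" for j s
    using borel_version_zero[OF V that] .
  have V_int: "integrable lborel (V j)" for j
    using int[of j] unfolding integrable_rl_kernel_lebesgue_on[OF V order_refl]
    by (intro integrable_of_integrable_rl_kernel[OF \<alpha>(2) borel_version_measurable[OF V] V0])
  have \<phi>_eq: "\<phi> t $ j = \<xi> $ j + rl_conv (\<alpha> j) (V j) t / Gamma (\<alpha> j)" if "t \<in> {0..T}" for t j
  proof -
    have "t \<le> T" using that by simp
    from integral_rl_kernel_lebesgue_on[OF V this] show ?thesis
      using eq that by (simp add: v_def)
  qed
  obtain \<gamma> C where \<gamma>: "\<gamma> \<in> Lp p T" and C: "0 < C"
    and growth: "\<And>x. AE t in lebesgue_on {0..T}. norm (f x t) \<le> C * norm x + \<gamma> t"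
    using f unfolding Lp_caratheodory_def by blast
  have "\<gamma> \<in> borel_measurable (lebesgue_on {0<..<T})" using \<gamma> by (simp add: Lp_def)
  then obtain G where G: "borel_version T \<gamma> G" by (rule borel_version_exists)
  have G_int: "integrable lborel (\<lambda>s. \<bar>G s\<bar> powr p)"
    using \<gamma> borel_version_integrable_powr[OF G, of p] by (simp add: Lp_def)
  have "AE t in lebesgue_on {0..T}. continuous_on UNIV (\<lambda>x. f x t)"
    using f by (simp add: Lp_caratheodory_def caratheodory_def)
  then have "AE t in lebesgue_on {0..T}. \<forall>x. norm (f x t) \<le> C * norm x + \<gamma> t"
    using growth by (rule AE_all_le_if_continuous)
  then have growth_all: "AE t in lborel. t \<in> {0<..<T} \<longrightarrow> (\<forall>x. norm (f x t) \<le> C * norm x + \<gamma> t)"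
    unfolding AE_lebesgue_on_Icc_iff by (simp add: AE_lebesgue_on_iff)
  define h where "h t = (\<Sum>j\<in>UNIV. \<bar>indicator {0<..<T} t * (\<xi> $ j + rl_conv (\<alpha> j) (V j) t / Gamma (\<alpha> j))\<bar>)" for t
  have norm_v: "AE s in lborel. s \<in> {0<..<T} \<longrightarrow> norm (v s) \<le> C * h s + \<bar>G s\<bar>"
    using growth_all borel_version_AE[OF G]
  proof eventually_elim
    case (elim s)
    show ?case
    proof
      assume s: "s \<in> {0<..<T}"
      have "norm (\<phi> s) \<le> (\<Sum>j\<in>UNIV. \<bar>\<phi> s $ j\<bar>)" by (rule norm_le_l1_cart)
      also have "\<dots> = h s" using s by (simp add: h_def \<phi>_eq)
      finally have "C * norm (\<phi> s) \<le> C * h s" using C by simp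
      moreover have "norm (v s) \<le> C * norm (\<phi> s) + G s" using elim s by (simp add: v_def)
      ultimately show "norm (v s) \<le> C * h s + \<bar>G s\<bar>" by linarith
    qed
  qed
  have h_nonneg: "0 \<le> h t" for t by (simp add: h_def sum_nonneg)
  have V_le: "AE s in lborel. \<bar>V j s\<bar> \<le> C * h s + \<bar>G s\<bar>" for j
    using norm_v borel_version_AE[OF V[of j]]
  proof eventually_elim
    case (elim s)
    show ?case
    proof (cases "s \<in> {0<..<T}")
      case True
      then show ?thesis
        using elim component_le_norm_cart[of "v s" j] by auto
    next
      case False
      then show ?thesis using V0[of s j] C h_nonneg[of s] by simp
    qed
  qed
  obtain B where B: "0 \<le> B" and hB: "AE t in lborel. h t \<le> B"
    using integral_equation_bounded[OF less_imp_le[OF C] V_int V0 borel_version_measurable[OF G] G_int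
        borel_version_zero[OF G] h_def V_le] by blast
  have CB: "0 \<le> C * B" using C B by simp
  have hCB: "AE t in lborel. C * h t \<le> C * B"
    using hB C by (auto elim!: eventually_mono)
  \<comment> \<open>With \<open>h\<close> bounded, the growth condition bounds \<open>V j\<close> by
    a constant plus an L^p function, which lifts it from L^1 to L^p.\<close>
  have V_powr: "integrable lborel (\<lambda>s. \<bar>V j s\<bar> powr p)" for j
  proof (rule integrable_powr_le[OF borel_version_measurable[OF V] borel_version_measurable[OF G] G_int _ CB V0])
    show "AE s in lborel. \<bar>V j s\<bar> \<le> C * B + \<bar>G s\<bar>"
      using V_le[of j] hCB by eventually_elim auto
  qed (use p in auto)
  have density: "Lp_density (\<alpha> j) p T (V j)" for j
    by unfold_locales (use \<alpha> p V_powr V0 borel_version_measurable[OF V] in auto)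
  have v_measurable: "v \<in> borel_measurable (lebesgue_on {0<..<T})"
    using vm by (rule borel_measurable_vec)
  have "v \<in> Lp p T"
  proof -
    \<comment> \<open>\<open>Lp\<close> concerns the norm of the whole vector, which therefore gets
      its own Borel representative.\<close>
    have "(\<lambda>t. norm (v t)) \<in> borel_measurable (lebesgue_on {0<..<T})"
      using v_measurable by measurable
    then obtain N where N: "borel_version T (\<lambda>t. norm (v t)) N"
      by (rule borel_version_exists)
    have "integrable lborel (\<lambda>s. \<bar>N s\<bar> powr p)"
    proof (rule integrable_powr_le[OF borel_version_measurable[OF N] borel_version_measurable[OF G] G_int _ CB])
      show "AE s in lborel. \<bar>N s\<bar> \<le> C * B + \<bar>G s\<bar>"
        using norm_v borel_version_AE[OF N] hCB
      proof eventually_elim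
        case (elim s)
        then show ?case
          using borel_version_zero[OF N, of s] CB norm_ge_zero[of "v s"]
          by (cases "s \<in> {0<..<T}") (auto simp del: norm_ge_zero)
      qed
    qed (use p borel_version_zero[OF N] in auto)
    then show ?thesis
      using borel_version_integrable_powr[OF N, of p] v_measurable by (simp add: Lp_def)
  qed
  moreover have "is_caputo_derivative T (\<alpha> j) (\<lambda>t. \<phi> t $ j) (\<lambda>t. v t $ j)" for j
    using Lp_density.rl_conv_imp_caputo_derivative(1)[OF density T V \<phi>_eq] .
  moreover have "continuous_on {0..T} \<phi>"
  proof -
    have "continuous_on {0..T} (\<lambda>t. \<chi> j. \<phi> t $ j)"
      using Lp_density.rl_conv_imp_caputo_derivative(2)[OF density T V \<phi>_eq]
      by (intro continuous_on_vec_lambda)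
    then show ?thesis by simp
  qed
  moreover have "\<phi> 0 $ j = \<xi> $ j" for j
    using \<phi>_eq[of 0 j] T Lp_density.rl_conv_zero[OF density[of j]] by simp
  ultimately show ?thesis
    unfolding cauchy_solution_def by (auto simp: v_def intro!: bexI[of _ v])
qed

end

theorem proposition11:
  fixes T p :: real
    and \<alpha> :: "'n::finite \<Rightarrow> real"
    and f :: "real^'n \<Rightarrow> real \<Rightarrow> real^'n"
    and \<xi> :: "real^'n"
    and \<phi> :: "real \<Rightarrow> real^'n"
  assumes "T > 0"
    and "\<And>j. 0 < \<alpha> j \<and> \<alpha> j \<le> 1"
    and "p > 1"
    and "p > Max (range (\<lambda>j. 1 / \<alpha> j))"
    and "Lp_caratheodory p T f"
  shows "cauchy_solution p T \<alpha> f \<xi> \<phi> \<longleftrightarrow>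
    (\<forall>j. \<forall>t\<in>{0..T}.
       integrable (lebesgue_on {0<..<t}) (\<lambda>s. (t - s) powr (\<alpha> j - 1) * f (\<phi> s) s $ j) \<and>
       \<phi> t $ j = \<xi> $ j +
         1 / Gamma (\<alpha> j) * (LINT s|lebesgue_on {0<..<t}. (t - s) powr (\<alpha> j - 1) * f (\<phi> s) s $ j))"
proof -
  have \<alpha>: "0 < \<alpha> j" "\<alpha> j \<le> 1" for j
    using assms(2) by auto
  have p: "1 / \<alpha> j < p" for j
    using Max_ge[of "range (\<lambda>j. 1 / \<alpha> j)" "1 / \<alpha> j"] assms(4) by force
  show ?thesis
  proof (intro iffI allI ballI conjI)
    fix j t assume "cauchy_solution p T \<alpha> f \<xi> \<phi>" "t \<in> {0..T}"
    from cauchy_solution_imp_integral_equation[OF assms(1) \<alpha> assms(3) p this]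
    show "integrable (lebesgue_on {0<..<t}) (\<lambda>s. (t - s) powr (\<alpha> j - 1) * f (\<phi> s) s $ j)"
      "\<phi> t $ j = \<xi> $ j +
         1 / Gamma (\<alpha> j) * (LINT s|lebesgue_on {0<..<t}. (t - s) powr (\<alpha> j - 1) * f (\<phi> s) s $ j)"
      by auto
  qed (rule integral_equation_imp_cauchy_solution[OF assms(1) \<alpha> assms(3) p assms(5)])
qed

end
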